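(* Let $m<0<n$ be integers with $\gcd(m,n)=1$ and suppose that the $\mathbb{Z}$-graded algebra $E_{(m,n)}^{(\infty,\infty)}$ is of type $(2)$ or $(3)$. Then $E_{(m,n)}^{(\infty,\infty)}$ generates the variety $\mathfrak{V}_1^{\mathbb{Z}}$; that is, $T_{\mathbb{Z}}(E_{(m,n)}^{(\infty,\infty)})=T_{\mathbb{Z}}(\mathfrak{V}_1^{\mathbb{Z}})$.
   Context: $F$ is a field of characteristic zero; all algebras are associative and unitary over $F$. $E$ is the infinite dimensional Grassmann algebra over $F$: $L$ is the vector space with basis $e_1,e_2,\ldots$, and $E$ has basis $B_E$ consisting of $1$ and all products $e_{i_1}\cdots e_{i_k}$ with $i_1<\cdots<i_k$, $k\ge 1$, with multiplication induced by $e_ie_j=-e_je_i$ for all $i,j$. The $\mathbb{Z}$-graded algebra $E_{(m,n)}^{(\infty,\infty)}=\bigoplus_{r\in\mathbb{Z}}A_r$: split the set $\{e_1,e_2,\ldots\}$ into two disjoint infinite subsets, spanning subspaces $L_m^{\infty}$ and $L_n^{\infty}$ with $L=L_m^{\infty}\oplus L_n^{\infty}$; set $\|e_k\|=m$ if $e_k\in L_m^\infty$ and $\|e_k\|=n$ if $e_k\in L_n^\infty$, and $\|e_{k_1}\cdots e_{k_s}\|=\|e_{k_1}\|+\cdots+\|e_{k_s}\|$ (and $\|1\|=0$); $A_r$ is the span of the elements of $B_E$ of degree $r$. Types: for $m<0<n$ with $\gcd(m,n)=1$ there exist non-negative integers $\alpha,\beta,\alpha',\beta'$ with $1=\alpha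 m+\beta n$ and $-1=\alpha' m+\beta' n$; fix such integers with $\alpha+\beta$ and $\alpha'+\beta'$ minimal. The grading is of type $(1)$ if $\alpha+\beta$ and $\alpha'+\beta'$ are both even; type $(2)$ if $\alpha+\beta$ is even and $\alpha'+\beta'$ is odd; type $(3)$ if $\alpha+\beta$ is odd and $\alpha'+\beta'$ is even; type $(4)$ if both are odd. Graded identities: $F\langle X|\mathbb{Z}\rangle$ is the free unitary associative algebra on the disjoint union $X=\bigcup_{i\in\mathbb{Z}}X_i$, $X_i=\{x_1^i,x_2^i,\ldots\}$, graded by giving the variables in $X_i$ degree $i$. $f(x_1^{l_1},\ldots,x_r^{l_r})$ is a graded identity of a $\mathbb{Z}$-graded algebra $A$ if $f(a_1,\ldots,a_r)=0$ for all $a_i\in A_{l_i}$; $T_{\mathbb{Z}}(A)$ is the set of all graded identities of $A$. A $T_{\mathbb{Z}}$-ideal is an ideal of $F\langle X|\mathbb{Z}\rangle$ invariant under all degree-preserving endomorphisms. $\mathfrak{V}_1^{\mathbb{Z}}$ is the variety of $\mathbb{Z}$-graded algebras defined by the identities $[x_1,x_2,x_3]=[[x_1,x_2],x_3]$ for all choices of $\mathbb{Z}$-degrees of the variables $x_1,x_2,x_3$; $T_{\mathbb{Z}}(\mathfrak{V}_1^{\mathbb{Z}})$ is the $T_{\mathbb{Z}}$-ideal generated by these polynomials. *)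

theory Defs
  imports Complex_Main "HOL-Library.Poly_Mapping"
begin

section \<open>The infinite-dimensional Grassmann algebra\<close>

text \<open>
  The basis vector \<open>e\<^sub>i\<^sub>1 \<cdots> e\<^sub>i\<^sub>k\<close> with \<open>i\<^sub>1 < \<cdots> < i\<^sub>k\<close> is indexed by the finite set
  \<open>{i\<^sub>1, \<dots>, i\<^sub>k}\<close>, and \<open>1\<close> by the empty set; generators are numbered from \<open>0\<close>.
  An element is its finitely supported family of coordinates.
\<close>

typedef (overloaded) 'f grassmann =
  "{a :: nat set \<Rightarrow> 'f::zero. finite {S. a S \<noteq> 0} \<and> (\<forall>S. a S \<noteq> 0 \<longrightarrow> finite S)}"
  morphisms coord Abs_grassmann
  by (rule exI[of _ "\<lambda>_. 0"]) simp

setup_lifting type_definition_grassmann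

text \<open>
  For disjoint finite \<open>S\<close>, \<open>T\<close>, sorting the product \<open>e\<^sub>S e\<^sub>T\<close> requires one transposition for
  every pair \<open>(s, t) \<in> S \<times> T\<close> with \<open>t < s\<close>, so \<open>e\<^sub>S e\<^sub>T = shuffle_sign S T e\<^sub>S\<^sub>\<union>\<^sub>T\<close>;
  if \<open>S\<close> and \<open>T\<close> meet, then \<open>e\<^sub>S e\<^sub>T = 0\<close>.
\<close>

definition shuffle_sign :: "nat set \<Rightarrow> nat set \<Rightarrow> 'f::ring_1" where
  "shuffle_sign S T = (- 1) ^ card {(s, t). s \<in> S \<and> t \<in> T \<and> t < s}"

lemma shuffle_sign_Un_left:
  assumes "finite S" "finite T" "finite U" "S \<inter> T = {}"
  shows "shuffle_sign (S \<union> T) U = shuffle_sign S U * (shuffle_sign T U :: 'f::ring_1)"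
proof -
  let ?P = "\<lambda>A B. {(s::nat, t). s \<in> A \<and> t \<in> B \<and> t < s}"
  have fin: "finite (?P A B)" if "finite A" "finite B" for A B
    by (rule finite_subset[of _ "A \<times> B"]) (use that in auto)
  have "?P (S \<union> T) U = ?P S U \<union> ?P T U" by auto
  moreover have "card (?P S U \<union> ?P T U) = card (?P S U) + card (?P T U)"
    using assms fin by (intro card_Un_disjoint) auto
  ultimately show ?thesis by (simp add: shuffle_sign_def power_add)
qed

lemma shuffle_sign_Un_right:
  assumes "finite S" "finite T" "finite U" "T \<inter> U = {}"
  shows "shuffle_sign S (T \<union> U) = shuffle_sign S T * (shuffle_sign S U :: 'f::ring_1)"
proof -
  let ?P = "\<lambda>A B. {(s::nat, t). s \<in> A \<and> t \<in> B \<and> t < s}"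
  have fin: "finite (?P A B)" if "finite A" "finite B" for A B
    by (rule finite_subset[of _ "A \<times> B"]) (use that in auto)
  have "?P S (T \<union> U) = ?P S T \<union> ?P S U" by auto
  moreover have "card (?P S T \<union> ?P S U) = card (?P S T) + card (?P S U)"
    using assms fin by (intro card_Un_disjoint) auto
  ultimately show ?thesis by (simp add: shuffle_sign_def power_add)
qed

lemma shuffle_sign_empty [simp]: "shuffle_sign {} T = 1" "shuffle_sign S {} = 1"
  by (simp_all add: shuffle_sign_def)

lemma coord_infinite: "infinite S \<Longrightarrow> coord a S = 0"
  using coord[of a] by auto

instantiation grassmann :: (comm_ring_1) ring_1
begin

lift_definition zero_grassmann :: "'a grassmann" is "\<lambda>_. 0" by simp

lift_definition one_grassmann :: "'a grassmann" is "\<lambda>S. if S = {} then 1 else 0" by simp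

lift_definition plus_grassmann :: "'a grassmann \<Rightarrow> 'a grassmann \<Rightarrow> 'a grassmann"
  is "\<lambda>a b S. a S + b S"
proof -
  fix a b :: "nat set \<Rightarrow> 'a"
  assume a: "finite {S. a S \<noteq> 0} \<and> (\<forall>S. a S \<noteq> 0 \<longrightarrow> finite S)"
    and b: "finite {S. b S \<noteq> 0} \<and> (\<forall>S. b S \<noteq> 0 \<longrightarrow> finite S)"
  have "{S. a S + b S \<noteq> 0} \<subseteq> {S. a S \<noteq> 0} \<union> {S. b S \<noteq> 0}" by auto
  with a b show "finite {S. a S + b S \<noteq> 0} \<and> (\<forall>S. a S + b S \<noteq> 0 \<longrightarrow> finite S)"
    by (metis (no_types, lifting) add_0 finite_UnI finite_subset)
qed

lift_definition uminus_grassmann :: "'a grassmann \<Rightarrow> 'a grassmann" is "\<lambda>a S. - a S" by simp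

definition minus_grassmann :: "'a grassmann \<Rightarrow> 'a grassmann \<Rightarrow> 'a grassmann" where
  "minus_grassmann a b = a + (- b)"

lift_definition times_grassmann :: "'a grassmann \<Rightarrow> 'a grassmann \<Rightarrow> 'a grassmann"
  is "\<lambda>a b S. \<Sum>T\<in>Pow S. shuffle_sign T (S - T) * a T * b (S - T)"
proof -
  fix a b :: "nat set \<Rightarrow> 'a"
  let ?ab = "\<lambda>S. \<Sum>T\<in>Pow S. shuffle_sign T (S - T) * a T * b (S - T)"
  assume a: "finite {S. a S \<noteq> 0} \<and> (\<forall>S. a S \<noteq> 0 \<longrightarrow> finite S)"
    and b: "finite {S. b S \<noteq> 0} \<and> (\<forall>S. b S \<noteq> 0 \<longrightarrow> finite S)"
  have ex: "\<exists>T\<subseteq>S. a T \<noteq> 0 \<and> b (S - T) \<noteq> 0" if "?ab S \<noteq> 0" for S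
  proof (rule ccontr)
    assume "\<not> (\<exists>T\<subseteq>S. a T \<noteq> 0 \<and> b (S - T) \<noteq> 0)"
    then have "?ab S = 0" by (intro sum.neutral) auto
    with that show False by simp
  qed
  have "{S. ?ab S \<noteq> 0} \<subseteq> (\<lambda>(T, U). T \<union> U) ` ({S. a S \<noteq> 0} \<times> {S. b S \<noteq> 0})"
  proof
    fix S assume "S \<in> {S. ?ab S \<noteq> 0}"
    then obtain T where "T \<subseteq> S" "a T \<noteq> 0" "b (S - T) \<noteq> 0" using ex by blast
    then show "S \<in> (\<lambda>(T, U). T \<union> U) ` ({S. a S \<noteq> 0} \<times> {S. b S \<noteq> 0})"
      by (intro image_eqI[of _ _ "(T, S - T)"]) auto
  qed
  then have "finite {S. ?ab S \<noteq> 0}"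
    using a b by (meson finite_SigmaI finite_imageI finite_subset)
  moreover have "finite S" if nz: "?ab S \<noteq> 0" for S
  proof -
    obtain T where "T \<subseteq> S" "a T \<noteq> 0" "b (S - T) \<noteq> 0" using ex[OF nz] by blast
    with a b have "finite T" "finite (S - T)" by auto
    then show ?thesis by (meson finite_Diff2)
  qed
  ultimately show "finite {S. ?ab S \<noteq> 0} \<and> (\<forall>S. ?ab S \<noteq> 0 \<longrightarrow> finite S)" by blast
qed

instance
proof
  fix a b c :: "'a grassmann"
  show "a + b + c = a + (b + c)" by transfer (simp add: add.assoc)
  show "a + b = b + a" by transfer (simp add: add.commute)
  show "0 + a = a" by transfer simp
  show "- a + a = 0" by transfer simp
  show "a - b = a + - b" by (simp add: minus_grassmann_def)
  show "(a + b) * c = a * c + b * c"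
    by transfer (simp add: algebra_simps sum.distrib)
  show "a * (b + c) = a * b + a * c"
    by transfer (simp add: algebra_simps sum.distrib)
  show "1 * a = a"
  proof (rule coord_inject[THEN iffD1], rule ext)
    fix S
    show "coord (1 * a) S = coord a S"
    proof (cases "finite S")
      case True
      have "coord (1 * a) S = (\<Sum>T\<in>Pow S. if T = {} then coord a S else 0)"
        unfolding times_grassmann.rep_eq one_grassmann.rep_eq by (rule sum.cong) auto
      then show ?thesis using True by simp
    qed (simp add: coord_infinite)
  qed
  show "a * 1 = a"
  proof (rule coord_inject[THEN iffD1], rule ext)
    fix S
    show "coord (a * 1) S = coord a S"
    proof (cases "finite S")
      case True
      have "coord (a * 1) S = (\<Sum>T\<in>Pow S. if T = S then coord a S else 0)"
        unfolding times_grassmann.rep_eq one_grassmann.rep_eq by (rule sum.cong) auto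
      then show ?thesis using True by simp
    qed (simp add: coord_infinite)
  qed
  show "a * b * c = a * (b * c)"
  proof (rule coord_inject[THEN iffD1], rule ext)
    fix S
    show "coord (a * b * c) S = coord (a * (b * c)) S"
    proof (cases "finite S")
      case S: True
      let ?g = "\<lambda>U V W. shuffle_sign U V * shuffle_sign U W * shuffle_sign V W
                          * coord a U * coord b V * coord c W"
      have fin: "finite T" if "T \<subseteq> S" for T using that S finite_subset by blast
      have "coord (a * b * c) S =
          (\<Sum>T\<in>Pow S. \<Sum>U\<in>Pow T. shuffle_sign T (S - T) *
             (shuffle_sign U (T - U) * coord a U * coord b (T - U)) * coord c (S - T))"
        unfolding times_grassmann.rep_eq by (simp add: sum_distrib_left sum_distrib_right)
      also have "\<dots> = (\<Sum>T\<in>Pow S. \<Sum>U\<in>Pow T. ?g U (T - U) (S - T))"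
      proof (intro sum.cong refl)
        fix T U assume TU: "T \<in> Pow S" "U \<in> Pow T"
        then have "shuffle_sign (U \<union> (T - U)) (S - T) =
            shuffle_sign U (S - T) * (shuffle_sign (T - U) (S - T) :: 'a)"
          by (intro shuffle_sign_Un_left) (auto intro: fin)
        moreover have "U \<union> (T - U) = T" using TU by auto
        ultimately have *: "shuffle_sign T (S - T) =
            shuffle_sign U (S - T) * (shuffle_sign (T - U) (S - T) :: 'a)" by simp
        show "shuffle_sign T (S - T) *
             (shuffle_sign U (T - U) * coord a U * coord b (T - U)) * coord c (S - T)
             = ?g U (T - U) (S - T)"
          unfolding * by (simp only: mult_ac)
      qed
      also have "\<dots> = (\<Sum>(T, U)\<in>(SIGMA T:Pow S. Pow T). ?g U (T - U) (S - T))"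
        by (rule sum.Sigma) (use S fin in auto)
      also have "\<dots> = (\<Sum>(U, V)\<in>(SIGMA U:Pow S. Pow (S - U)). ?g U V (S - U - V))"
      proof (rule sum.reindex_bij_witness[of _ "\<lambda>(U, V). (U \<union> V, U)" "\<lambda>(T, U). (U, T - U)"])
        fix p assume "p \<in> (SIGMA T:Pow S. Pow T)"
        then obtain T U where p: "p = (T, U)" "T \<subseteq> S" "U \<subseteq> T" by auto
        then have "S - U - (T - U) = S - T" by auto
        with p show "(case case p of (T, U) \<Rightarrow> (U, T - U) of (U, V) \<Rightarrow> ?g U V (S - U - V))
            = (case p of (T, U) \<Rightarrow> ?g U (T - U) (S - T))" by simp
      qed auto
      also have "\<dots> = (\<Sum>U\<in>Pow S. \<Sum>V\<in>Pow (S - U). ?g U V (S - U - V))"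
        by (rule sum.Sigma[symmetric]) (use S in auto)
      also have "\<dots> = (\<Sum>U\<in>Pow S. \<Sum>V\<in>Pow (S - U). shuffle_sign U (S - U) * coord a U *
          (shuffle_sign V (S - U - V) * coord b V * coord c (S - U - V)))"
      proof (intro sum.cong refl)
        fix U V assume UV: "U \<in> Pow S" "V \<in> Pow (S - U)"
        then have "shuffle_sign U (V \<union> (S - U - V)) =
            shuffle_sign U V * (shuffle_sign U (S - U - V) :: 'a)"
          by (intro shuffle_sign_Un_right) (auto intro: fin)
        moreover have "V \<union> (S - U - V) = S - U" using UV by auto
        ultimately have *: "shuffle_sign U (S - U) =
            shuffle_sign U V * (shuffle_sign U (S - U - V) :: 'a)" by simp
        show "?g U V (S - U - V) = shuffle_sign U (S - U) * coord a U *
          (shuffle_sign V (S - U - V) * coord b V * coord c (S - U - V))"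
          unfolding * by (simp only: mult_ac)
      qed
      also have "\<dots> = coord (a * (b * c)) S"
        unfolding times_grassmann.rep_eq by (simp add: sum_distrib_left)
      finally show ?thesis .
    qed (simp add: coord_infinite)
  qed
  show "(0 :: 'a grassmann) \<noteq> 1"
    by transfer (metis zero_neq_one)
qed

end

lift_definition grassmann_scale :: "'f::field \<Rightarrow> 'f grassmann \<Rightarrow> 'f grassmann"
  is "\<lambda>c a S. c * a S"
  by (auto intro: rev_finite_subset)

global_interpretation grassmann: vector_space grassmann_scale
  by standard (transfer; simp add: algebra_simps)+

lemma grassmann_scale_mult_left: "grassmann_scale c a * b = grassmann_scale c (a * b)"
  by transfer (simp add: sum_distrib_left mult_ac)

lemma grassmann_scale_mult_right: "a * grassmann_scale c b = grassmann_scale c (a * b)"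
  by transfer (simp add: sum_distrib_left mult_ac)

text \<open>The value on infinite sets is 0.\<close>

lift_definition grassmann_basis :: "nat set \<Rightarrow> 'f::field grassmann"
  is "\<lambda>S T. if T = S \<and> finite S then 1 else 0"
  by auto

definition grassmann_gen :: "nat \<Rightarrow> 'f::field grassmann" where
  "grassmann_gen i = grassmann_basis {i}"

lemma grassmann_basis_mult:
  assumes "finite S" "finite T"
  shows "grassmann_basis S * grassmann_basis T =
    (if S \<inter> T = {} then grassmann_scale (shuffle_sign S T) (grassmann_basis (S \<union> T)) else 0)"
proof (rule coord_inject[THEN iffD1], rule ext)
  fix R
  show "coord (grassmann_basis S * grassmann_basis T) R = coord (if S \<inter> T = {}
      then grassmann_scale (shuffle_sign S T) (grassmann_basis (S \<union> T)) else 0 :: 'a grassmann) R"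
  proof (cases "finite R")
    case True
    have "coord (grassmann_basis S * grassmann_basis T :: 'a grassmann) R =
       (\<Sum>U\<in>Pow R. if U = S then (if R - S = T then shuffle_sign S T else 0) else 0)"
      unfolding times_grassmann.rep_eq grassmann_basis.rep_eq
      by (rule sum.cong) (use assms in auto)
    also have "\<dots> = (if S \<subseteq> R \<and> R - S = T then shuffle_sign S T else 0)"
      using True by simp
    also have "S \<subseteq> R \<and> R - S = T \<longleftrightarrow> S \<inter> T = {} \<and> R = S \<union> T" by auto
    finally show ?thesis
      using assms by (simp add: grassmann_scale.rep_eq grassmann_basis.rep_eq zero_grassmann.rep_eq)
  qed (simp add: coord_infinite)
qed

lemma grassmann_gen_anticommute:
  "grassmann_gen i * grassmann_gen j = - (grassmann_gen j * grassmann_gen i :: 'f::field grassmann)"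
proof (cases "i = j")
  case False
  have *: "{(s, t). s = i \<and> t = j \<and> t < s} = (if j < i then {(i, j)} else {})" for i j :: nat
    by auto
  show ?thesis
    using False
    by (cases "i < j") (simp_all add: grassmann_gen_def grassmann_basis_mult shuffle_sign_def *
        insert_commute grassmann.scale_minus_left)
qed (simp add: grassmann_gen_def grassmann_basis_mult)

lemma grassmann_basis_eq_prod_list:
  assumes "sorted_wrt (<) is"
  shows "grassmann_basis (set is) = prod_list (map grassmann_gen is :: 'f::field grassmann list)"
  using assms
proof (induction "is")
  case Nil
  show ?case by (simp, transfer) (auto simp: fun_eq_iff)
next
  case (Cons i "is")
  then have inv: "{(s, t). s = i \<and> t \<in> set is \<and> t < s} = {}" and ni: "i \<notin> set is"
    by auto
  have IH: "prod_list (map grassmann_gen is) = (grassmann_basis (set is) :: 'f grassmann)"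
    using Cons by simp
  show ?case
    using ni by (simp add: IH grassmann_gen_def[of i] grassmann_basis_mult shuffle_sign_def inv)
qed

text \<open>
  The set \<open>J\<close> contains the indices of the generators of degree \<open>m\<close>; the others have degree \<open>n\<close>.
\<close>

definition basis_degree :: "int \<Rightarrow> int \<Rightarrow> nat set \<Rightarrow> nat set \<Rightarrow> int" where
  "basis_degree m n J S = (\<Sum>k\<in>S. if k \<in> J then m else n)"

definition grassmann_component ::
  "int \<Rightarrow> int \<Rightarrow> nat set \<Rightarrow> int \<Rightarrow> 'f::field grassmann set" where
  "grassmann_component m n J r =
     grassmann.span {grassmann_basis S | S. finite S \<and> basis_degree m n J S = r}"


section \<open>Types of gradings\<close>

definition minimal_representation :: "int \<Rightarrow> int \<Rightarrow> int \<Rightarrow> nat \<Rightarrow> nat \<Rightarrow> bool" where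
  "minimal_representation m n d \<alpha> \<beta> \<longleftrightarrow>
     d = int \<alpha> * m + int \<beta> * n \<and>
     (\<forall>\<gamma> \<delta>. d = int \<gamma> * m + int \<delta> * n \<longrightarrow> \<alpha> + \<beta> \<le> \<gamma> + \<delta>)"

text \<open>
  All minimal representations have the same sum, so the type does not depend on the choice.
\<close>

definition has_grading_type :: "int \<Rightarrow> int \<Rightarrow> nat \<Rightarrow> bool" where
  "has_grading_type m n t \<longleftrightarrow>
     (\<exists>\<alpha> \<beta> \<alpha>' \<beta>'. minimal_representation m n 1 \<alpha> \<beta> \<and> minimal_representation m n (- 1) \<alpha>' \<beta>' \<and>
        (t = 1 \<and> even (\<alpha> + \<beta>) \<and> even (\<alpha>' + \<beta>') \<or>
         t = 2 \<and> even (\<alpha> + \<beta>) \<and> odd (\<alpha>' + \<beta>') \<or>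
         t = 3 \<and> odd (\<alpha> + \<beta>) \<and> even (\<alpha>' + \<beta>') \<or>
         t = 4 \<and> odd (\<alpha> + \<beta>) \<and> odd (\<alpha>' + \<beta>')))"


section \<open>The free graded algebra and graded identities\<close>

text \<open>
  With words as a monoid under concatenation, the convolution product of
  \<^theory>\<open>HOL-Library.Poly_Mapping\<close> makes finitely supported functions on words the free
  unitary associative algebra.
\<close>

instantiation list :: (type) monoid_add
begin

definition zero_list :: "'a list" where "zero_list = []"

definition plus_list :: "'a list \<Rightarrow> 'a list \<Rightarrow> 'a list" where "plus_list = (@)"

instance by standard (simp_all add: zero_list_def plus_list_def)

end

text \<open>\<open>GVar i k\<close> is the variable \<open>x\<^sub>k\<^sup>i\<close> of degree \<open>i\<close>.\<close>

datatype gvar = GVar (var_degree: int) (var_index: nat)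

type_synonym 'f free_algebra = "gvar list \<Rightarrow>\<^sub>0 'f"

abbreviation word :: "gvar list \<Rightarrow> 'f::field free_algebra" where
  "word w \<equiv> Poly_Mapping.single w 1"

definition free_scale :: "'f::field \<Rightarrow> 'f free_algebra \<Rightarrow> 'f free_algebra" where
  "free_scale c = Poly_Mapping.map ((*) c)"

lemma lookup_free_scale [simp]:
  "Poly_Mapping.lookup (free_scale c f) w = c * Poly_Mapping.lookup f w"
  unfolding free_scale_def by transfer (simp add: when_def)

global_interpretation free: vector_space free_scale
  by standard (simp_all add: poly_mapping_eq_iff fun_eq_iff lookup_add algebra_simps)

definition free_component :: "int \<Rightarrow> 'f::field free_algebra set" where
  "free_component r = free.span {word w | w. sum_list (map var_degree w) = r}"

text \<open>
  The image of a polynomial under the substitution \<open>\<phi>\<close> of the variables, in an algebra with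
  scalar multiplication \<open>scale\<close>.
\<close>

definition free_eval ::
  "('f::field \<Rightarrow> 'a \<Rightarrow> 'a) \<Rightarrow> (gvar \<Rightarrow> 'a::ring_1) \<Rightarrow> 'f free_algebra \<Rightarrow> 'a" where
  "free_eval scale \<phi> f =
     (\<Sum>w\<in>Poly_Mapping.keys f. scale (Poly_Mapping.lookup f w) (prod_list (map \<phi> w)))"

text \<open>A graded algebra is given by its scalar multiplication and its family of components.\<close>

definition graded_identities ::
  "('f::field \<Rightarrow> 'a \<Rightarrow> 'a) \<Rightarrow> (int \<Rightarrow> 'a::ring_1 set) \<Rightarrow> 'f free_algebra set" where
  "graded_identities scale A =
     {f. \<forall>\<phi>. (\<forall>x. \<phi> x \<in> A (var_degree x)) \<longrightarrow> free_eval scale \<phi> f = 0}"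

definition two_sided_ideal :: "'a::ring_1 set \<Rightarrow> bool" where
  "two_sided_ideal I \<longleftrightarrow>
     0 \<in> I \<and> (\<forall>a\<in>I. \<forall>b\<in>I. a + b \<in> I) \<and> (\<forall>a\<in>I. \<forall>b. b * a \<in> I \<and> a * b \<in> I)"

definition graded_endomorphism :: "('f::field free_algebra \<Rightarrow> 'f free_algebra) \<Rightarrow> bool" where
  "graded_endomorphism \<psi> \<longleftrightarrow>
     Vector_Spaces.linear free_scale free_scale \<psi> \<and>
     \<psi> 1 = 1 \<and> (\<forall>f g. \<psi> (f * g) = \<psi> f * \<psi> g) \<and>
     (\<forall>r. \<psi> ` free_component r \<subseteq> free_component r)"

definition TZ_ideal :: "'f::field free_algebra set \<Rightarrow> bool" where
  "TZ_ideal I \<longleftrightarrow> two_sided_ideal I \<and> (\<forall>\<psi>. graded_endomorphism \<psi> \<longrightarrow> \<psi> ` I \<subseteq> I)"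

definition TZ_ideal_generated :: "'f::field free_algebra set \<Rightarrow> 'f free_algebra set" where
  "TZ_ideal_generated P = \<Inter> {I. TZ_ideal I \<and> P \<subseteq> I}"

definition commutator :: "'a::ring_1 \<Rightarrow> 'a \<Rightarrow> 'a" where
  "commutator a b = a * b - b * a"

definition TZ_V1 :: "'f::field free_algebra set" where
  "TZ_V1 = TZ_ideal_generated
     {commutator (commutator (word [GVar i 1]) (word [GVar j 2])) (word [GVar k 3]) | i j k. True}"

end

theory Submission
  imports Defs "HOL-Library.Multiset"
begin

text \<open>
  The Grassmann algebra satisfies \<open>[x, y, z] = 0\<close>: monomials of even length are central, and the
  commutator of two monomials of odd length is a multiple of one of even length. As the identities
  of a graded algebra form a \<open>T\<close>-ideal, this gives one inclusion (\<open>grassmann_triple_commutator\<close>,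
  \<open>TZ_ideal_graded_identities\<close>).

  For the other one, let \<open>T\<close> be the \<open>T\<close>-ideal of the triple commutators. Modulo \<open>T\<close> commutators are
  central and \<open>[a, b][c, d] = - [a, c][b, d]\<close>, so that a product of commutators is an alternating
  function of all its entries. Hence every polynomial is, modulo \<open>T\<close>, a linear combination of normal
  forms \<open>u\<^sub>1 \<cdots> u\<^sub>k [v\<^sub>1, v\<^sub>2] \<cdots> [v\<^sub>2\<^sub>l\<^sub>-\<^sub>1, v\<^sub>2\<^sub>l]\<close>, one for each multiset of variables \<open>u\<^sub>i\<close>
  and each set of variables \<open>v\<^sub>j\<close> of even size (\<open>span_normal_forms\<close>). It remains to show that a
  linear combination of normal forms that vanishes identically on the Grassmann algebra is trivial.

  This is where the type enters. In types (2) and (3) the number \<open>n - m\<close> is odd, so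
  the degree 0 monomials with \<open>n\<close> generators of degree \<open>m\<close> and \<open>- m\<close> generators of degree \<open>n\<close> have odd
  length. Therefore every homogeneous component contains monomials of even and of odd length that
  avoid any given finite set of generators (\<open>exists_monomial_of_degree_and_parity\<close>). For a term
  of the combination that is minimal for the number of \<open>v\<^sub>j\<close>, and then for the number of \<open>u\<^sub>i\<close>,
  choose monomials \<open>b\<^sub>1, \<dots>, b\<^sub>k\<close> of even length and \<open>c\<^sub>1, \<dots>, c\<^sub>2\<^sub>l\<close> of odd length with disjoint supports,
  where \<open>b\<^sub>i\<close> has the degree of \<open>u\<^sub>i\<close> and \<open>c\<^sub>j\<close> that of \<open>v\<^sub>j\<close>, and substitute for each variable \<open>x\<close>
  the sum of all \<open>b\<^sub>i\<close> with \<open>u\<^sub>i = x\<close> and all \<open>c\<^sub>j\<close> with \<open>v\<^sub>j = x\<close>. The chosen term then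
  becomes a nonzero integer multiple of \<open>b\<^sub>1 \<cdots> b\<^sub>k c\<^sub>1 \<cdots> c\<^sub>2\<^sub>l\<close>, and all other terms vanish (\<open>separating_substitution\<close>): a term with some
  other variable inside a commutator dies because the value of that variable is central, and one with
  the same commutators but other \<open>u\<^sub>i\<close> dies because the \<open>b\<^sub>i\<close> commute and have
  square zero, so that a nonzero product of at least \<open>k\<close> of them contains each exactly once.
  So the coefficient of the chosen term is 0.
\<close>

section \<open>Evaluation of polynomials in graded algebras\<close>

lemma poly_mapping_single_induct [case_names single add]:
  assumes "\<And>w c. P (Poly_Mapping.single w c)" and "\<And>f g. P f \<Longrightarrow> P g \<Longrightarrow> P (f + g)"
  shows "P (f :: 'a \<Rightarrow>\<^sub>0 'b::comm_monoid_add)"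
proof -
  have "P (\<Sum>w\<in>B. Poly_Mapping.single w (Poly_Mapping.lookup f w))" if "finite B" for B
    using that by (induction B) (auto intro: assms simp del: single_zero simp: single_zero[symmetric, of undefined])
  moreover have "(\<Sum>w\<in>Poly_Mapping.keys f. Poly_Mapping.single w (Poly_Mapping.lookup f w)) = f"
    by (rule poly_mapping_eqI) (auto simp: lookup_sum lookup_single when_def in_keys_iff)
  ultimately show ?thesis using finite_keys by metis
qed

locale assoc_algebra = vector_space scale
  for scale :: "'f::field \<Rightarrow> 'a::ring_1 \<Rightarrow> 'a" +
  assumes scale_mult_left: "scale c a * b = scale c (a * b)"
    and scale_mult_right: "a * scale c b = scale c (a * b)"
begin

lemma span_mult:
  assumes "a \<in> span P" "b \<in> span Q" and PQ: "\<And>p q. p \<in> P \<Longrightarrow> q \<in> Q \<Longrightarrow> p * q \<in> span R"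
  shows "a * b \<in> span R"
proof -
  have left: "p * b \<in> span R" if p: "p \<in> P" for p
    using \<open>b \<in> span Q\<close>
    by (induction rule: span_induct_alt)
      (auto simp: distrib_left scale_mult_right span_zero intro!: span_add span_scale PQ p)
  show ?thesis
    using \<open>a \<in> span P\<close>
    by (induction rule: span_induct_alt)
      (auto simp: distrib_right scale_mult_left span_zero intro!: span_add span_scale left)
qed

lemma free_eval_superset:
  assumes "finite B" "Poly_Mapping.keys f \<subseteq> B"
  shows "free_eval scale \<phi> f = (\<Sum>w\<in>B. scale (Poly_Mapping.lookup f w) (prod_list (map \<phi> w)))"
  unfolding free_eval_def
  by (rule sum.mono_neutral_left) (use assms in \<open>auto simp: in_keys_iff\<close>)

lemma free_eval_single: "free_eval scale \<phi> (Poly_Mapping.single w c) = scale c (prod_list (map \<phi> w))"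
  by (subst free_eval_superset[of "{w}"]) auto

lemma free_eval_0 [simp]: "free_eval scale \<phi> 0 = 0"
  by (simp add: free_eval_def)

lemma free_eval_word: "free_eval scale \<phi> (word w) = prod_list (map \<phi> w)"
  by (simp add: free_eval_single)

lemma free_eval_add: "free_eval scale \<phi> (f + g) = free_eval scale \<phi> f + free_eval scale \<phi> g"
proof -
  let ?B = "Poly_Mapping.keys f \<union> Poly_Mapping.keys g"
  have "Poly_Mapping.keys (f + g) \<subseteq> ?B" by (rule Poly_Mapping.keys_add)
  then show ?thesis
    by (simp add: free_eval_superset[of ?B] lookup_add scale_left_distrib sum.distrib)
qed

lemma free_eval_scale: "free_eval scale \<phi> (free_scale c f) = scale c (free_eval scale \<phi> f)"
proof -
  have "Poly_Mapping.keys (free_scale c f) \<subseteq> Poly_Mapping.keys f"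
    by (auto simp: in_keys_iff)
  then show ?thesis
    by (simp add: free_eval_superset[of "Poly_Mapping.keys f"] scale_sum_right)
qed

lemma free_eval_diff: "free_eval scale \<phi> (f - g) = free_eval scale \<phi> f - free_eval scale \<phi> g"
  using free_eval_add[of \<phi> "f - g" g] by (simp add: algebra_simps)

lemma free_eval_sum: "free_eval scale \<phi> (\<Sum>i\<in>I. f i) = (\<Sum>i\<in>I. free_eval scale \<phi> (f i))"
  by (induction I rule: infinite_finite_induct) (simp_all add: free_eval_add)

lemma free_eval_one: "free_eval scale \<phi> 1 = 1"
  using free_eval_word[of \<phi> "[]"] by (simp add: single_one[symmetric] zero_list_def)

lemma free_eval_mult: "free_eval scale \<phi> (f * g) = free_eval scale \<phi> f * free_eval scale \<phi> g"
proof -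
  have single: "free_eval scale \<phi> (Poly_Mapping.single v c * g) =
      free_eval scale \<phi> (Poly_Mapping.single v c) * free_eval scale \<phi> g" for v c
    by (induction g rule: poly_mapping_single_induct)
      (simp_all add: mult_single plus_list_def free_eval_single scale_mult_left scale_mult_right
        free_eval_add distrib_left mult.commute)
  show ?thesis
    by (induction f rule: poly_mapping_single_induct)
      (simp_all add: single free_eval_add distrib_right)
qed

lemma free_eval_commutator:
  "free_eval scale \<phi> (commutator f g) = commutator (free_eval scale \<phi> f) (free_eval scale \<phi> g)"
  by (simp add: commutator_def free_eval_diff free_eval_mult)

end

locale graded_algebra = assoc_algebra scale
  for scale :: "'f::field \<Rightarrow> 'a::ring_1 \<Rightarrow> 'a" +
  fixes A :: "int \<Rightarrow> 'a set"
  assumes subspace_component: "subspace (A r)"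
    and one_component: "1 \<in> A 0"
    and mult_component: "a \<in> A r \<Longrightarrow> b \<in> A s \<Longrightarrow> a * b \<in> A (r + s)"
begin

lemma prod_list_component:
  assumes "\<And>x. \<phi> x \<in> A (var_degree x)"
  shows "prod_list (map \<phi> w) \<in> A (sum_list (map var_degree w))"
  by (induction w) (auto simp: one_component intro!: mult_component assms)

lemma free_eval_component:
  assumes "\<And>x. \<phi> x \<in> A (var_degree x)" "f \<in> free_component r"
  shows "free_eval scale \<phi> f \<in> A r"
  using assms(2) unfolding free_component_def
proof (induction rule: free.span_induct_alt)
  case base
  show ?case by (simp add: subspace_0 subspace_component)
next
  case (step c x y)
  then show ?case
    using prod_list_component[OF assms(1)]
    by (auto simp: free_eval_add free_eval_scale free_eval_word
        intro!: subspace_add subspace_scale subspace_component)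
qed

end

section \<open>The free algebra as a graded algebra\<close>

lemma word_append: "word (v @ w) = word v * word w"
  by (simp add: mult_single plus_list_def)

lemma word_Nil: "word [] = 1"
  by (simp add: single_one[symmetric] zero_list_def)

lemma free_scale_eq_mult: "free_scale c f = Poly_Mapping.single [] c * f"
proof (induction f rule: poly_mapping_single_induct)
  case (single w d)
  show ?case
    by (rule poly_mapping_eqI) (simp add: mult_single plus_list_def lookup_single when_def)
qed (simp add: free.scale_right_distrib distrib_left)

lemma span_words: "free.span (range word) = UNIV"
proof -
  have "f \<in> free.span (range word)" for f :: "'a free_algebra"
  proof (induction f rule: poly_mapping_single_induct)
    case (single w c)
    have "Poly_Mapping.single w c = free_scale c (word w)"
      by (rule poly_mapping_eqI) (simp add: lookup_single when_def)
    then show ?case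
      by (auto intro: free.span_scale free.span_base)
  qed (rule free.span_add)
  then show ?thesis by blast
qed

global_interpretation free: assoc_algebra free_scale
proof unfold_locales
  fix c :: 'a and f g :: "'a free_algebra"
  show "free_scale c f * g = free_scale c (f * g)"
    by (simp add: free_scale_eq_mult mult.assoc)
  have *: "Poly_Mapping.single [] c * f = f * Poly_Mapping.single [] c" for f :: "'a free_algebra"
    by (induction f rule: poly_mapping_single_induct)
      (simp_all add: mult_single plus_list_def mult.commute distrib_left distrib_right)
  have "f * (Poly_Mapping.single [] c * g) = (Poly_Mapping.single [] c * f) * g"
    by (simp only: *[of f] mult.assoc)
  then show "f * free_scale c g = free_scale c (f * g)"
    by (simp add: free_scale_eq_mult mult.assoc)
qed

lemma word_in_free_component: "word w \<in> free_component (sum_list (map var_degree w))"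
  unfolding free_component_def by (rule free.span_base) blast

global_interpretation free: graded_algebra free_scale free_component
proof unfold_locales
  show "free.subspace (free_component r)" for r
    unfolding free_component_def by simp
  show "(1 :: 'a free_algebra) \<in> free_component 0"
    using word_in_free_component[of "[]"] by (simp add: word_Nil)
  show "f * g \<in> free_component (r + s)"
    if "f \<in> free_component r" "g \<in> free_component s" for f g :: "'a free_algebra" and r s
    using that unfolding free_component_def
    by (rule free.span_mult) (force simp: word_append[symmetric] simp del: word_append intro!: free.span_base)
qed

lemma graded_endomorphism_component:
  assumes "graded_endomorphism \<psi>" "f \<in> free_component r"
  shows "\<psi> f \<in> free_component r"
proof -
  have "\<forall>r. \<psi> ` free_component r \<subseteq> free_component r"
    using assms(1) unfolding graded_endomorphism_def by (elim conjE)
  with assms(2) show ?thesis by blast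
qed

lemma graded_endomorphism_free_eval:
  assumes "\<And>x. \<phi> x \<in> free_component (var_degree x)"
  shows "graded_endomorphism (free_eval free_scale \<phi>)"
  unfolding graded_endomorphism_def
proof (intro conjI allI)
  show "Vector_Spaces.linear free_scale free_scale (free_eval free_scale \<phi>)"
    by unfold_locales (simp_all add: free.free_eval_add free.free_eval_scale)
  show "free_eval free_scale \<phi> ` free_component r \<subseteq> free_component r" for r
    using free.free_eval_component[OF assms] by blast
qed (simp_all add: free.free_eval_one free.free_eval_mult)

text \<open>
  Substituting after an endomorphism is again a substitution; this makes the set of identities of a
  graded algebra invariant under endomorphisms.
\<close>

lemma graded_endomorphism_eval:
  fixes scale :: "'f::field \<Rightarrow> 'a::ring_1 \<Rightarrow> 'a"
  assumes "assoc_algebra scale" "graded_endomorphism \<psi>"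
  shows "free_eval scale \<phi> (\<psi> f) = free_eval scale (\<lambda>x. free_eval scale \<phi> (\<psi> (word [x]))) f"
proof -
  interpret assoc_algebra scale by fact
  interpret lin: Vector_Spaces.linear free_scale free_scale \<psi>
    using assms(2) by (simp add: graded_endomorphism_def)
  have hom: "\<psi> 1 = 1" "\<And>f g. \<psi> (f * g) = \<psi> f * \<psi> g"
    using assms(2) by (auto simp: graded_endomorphism_def)
  define \<chi> where "\<chi> = (\<lambda>x. free_eval scale \<phi> (\<psi> (word [x])))"
  have words: "free_eval scale \<phi> (\<psi> (word w)) = prod_list (map \<chi> w)" for w
  proof (induction w)
    case (Cons x w)
    have "word (x # w) = word [x] * (word w :: 'f free_algebra)" using word_append[of "[x]" w] by simp
    then have "free_eval scale \<phi> (\<psi> (word (x # w))) =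
        free_eval scale \<phi> (\<psi> (word [x])) * free_eval scale \<phi> (\<psi> (word w))"
      by (simp only: hom free_eval_mult)
    then show ?case using Cons.IH by (simp add: \<chi>_def)
  qed (simp add: word_Nil hom free_eval_one)
  have "f \<in> free.span (range word)" by (simp add: span_words)
  then have "free_eval scale \<phi> (\<psi> f) = free_eval scale \<chi> f"
    by (induction rule: free.span_induct_alt)
      (auto simp: lin.zero lin.add lin.scale free_eval_add free_eval_scale words free_eval_word)
  then show ?thesis by (simp only: \<chi>_def)
qed

lemma (in graded_algebra) TZ_ideal_graded_identities: "TZ_ideal (graded_identities scale A)"
  unfolding TZ_ideal_def two_sided_ideal_def
proof (intro conjI allI impI ballI)
  fix \<psi> :: "'f free_algebra \<Rightarrow> 'f free_algebra" assume \<psi>: "graded_endomorphism \<psi>"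
  show "\<psi> ` graded_identities scale A \<subseteq> graded_identities scale A"
  proof (clarsimp simp: graded_identities_def)
    fix f \<phi> assume f: "\<forall>\<phi>. (\<forall>x. \<phi> x \<in> A (var_degree x)) \<longrightarrow> free_eval scale \<phi> f = 0"
      and \<phi>: "\<forall>x. \<phi> x \<in> A (var_degree x)"
    have "\<psi> (word [x]) \<in> free_component (var_degree x)" for x
      by (rule graded_endomorphism_component[OF \<psi>]) (use word_in_free_component[of "[x]"] in simp)
    then have "free_eval scale \<phi> (\<psi> (word [x])) \<in> A (var_degree x)" for x
      using \<phi> by (intro free_eval_component) auto
    then have "free_eval scale (\<lambda>x. free_eval scale \<phi> (\<psi> (word [x]))) f = 0"
      by (intro f[THEN spec, THEN mp] allI)
    with graded_endomorphism_eval[OF assoc_algebra_axioms \<psi>]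
    show "free_eval scale \<phi> (\<psi> f) = 0" by (rule trans)
  qed
qed (auto simp: graded_identities_def free_eval_add free_eval_mult)

text \<open>part 2\<close>

section \<open>The ideal generated by the triple commutators\<close>

lemma two_sided_idealD:
  assumes "two_sided_ideal I"
  shows two_sided_ideal_zero: "0 \<in> I"
    and two_sided_ideal_add: "a \<in> I \<Longrightarrow> b \<in> I \<Longrightarrow> a + b \<in> I"
    and two_sided_ideal_mult_left: "a \<in> I \<Longrightarrow> b * a \<in> I"
    and two_sided_ideal_mult_right: "a \<in> I \<Longrightarrow> a * b \<in> I"
    and two_sided_ideal_diff: "a \<in> I \<Longrightarrow> b \<in> I \<Longrightarrow> a - b \<in> I"
proof -
  show *: "0 \<in> I" "a \<in> I \<Longrightarrow> b \<in> I \<Longrightarrow> a + b \<in> I" "a \<in> I \<Longrightarrow> b * a \<in> I" "a \<in> I \<Longrightarrow> a * b \<in> I" for a b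
    using assms by (auto simp: two_sided_ideal_def)
  show "a - b \<in> I" if "a \<in> I" "b \<in> I"
    using *(2)[OF that(1) *(3)[OF that(2), of "- 1"]] by simp
qed

lemma TZ_idealD:
  assumes "TZ_ideal I"
  shows TZ_ideal_two_sided: "two_sided_ideal I"
    and TZ_ideal_endomorphism: "graded_endomorphism \<psi> \<Longrightarrow> a \<in> I \<Longrightarrow> \<psi> a \<in> I"
proof -
  show "two_sided_ideal I"
    using assms unfolding TZ_ideal_def by (rule conjunct1)
  have "\<forall>\<psi>. graded_endomorphism \<psi> \<longrightarrow> \<psi> ` I \<subseteq> I"
    using assms unfolding TZ_ideal_def by (rule conjunct2)
  then show "graded_endomorphism \<psi> \<Longrightarrow> a \<in> I \<Longrightarrow> \<psi> a \<in> I" by blast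
qed

lemma TZ_ideal_Inter:
  assumes F: "\<And>I. I \<in> F \<Longrightarrow> TZ_ideal I"
  shows "TZ_ideal (\<Inter> F)"
  unfolding TZ_ideal_def two_sided_ideal_def
proof (intro conjI ballI allI impI subsetI InterI; (elim imageE)?)
  fix I assume I: "I \<in> F"
  note ideal = two_sided_idealD[OF TZ_ideal_two_sided[OF F[OF I]]]
  show "0 \<in> I" by (rule ideal)
  show "a + b \<in> I" if "a \<in> \<Inter> F" "b \<in> \<Inter> F" for a b
    using that I by (intro ideal(2)) auto
  show "b * a \<in> I" if "a \<in> \<Inter> F" for a b
    using that I by (intro ideal(3)) auto
  show "a * b \<in> I" if "a \<in> \<Inter> F" for a b
    using that I by (intro ideal(4)) auto
  show "b \<in> I" if "graded_endomorphism \<psi>" "b = \<psi> a" "a \<in> \<Inter> F" for \<psi> a b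
    using that I TZ_ideal_endomorphism[OF F[OF I]] by blast
qed

lemma TZ_ideal_TZ_V1: "TZ_ideal TZ_V1"
  unfolding TZ_V1_def TZ_ideal_generated_def by (rule TZ_ideal_Inter) simp

lemma TZ_V1_least:
  assumes "TZ_ideal I" "\<And>i j k.
    commutator (commutator (word [GVar i 1]) (word [GVar j 2])) (word [GVar k 3]) \<in> I"
  shows "TZ_V1 \<subseteq> I"
  using assms unfolding TZ_V1_def TZ_ideal_generated_def by blast

lemma two_sided_ideal_TZ_V1: "two_sided_ideal TZ_V1"
  by (rule TZ_ideal_two_sided[OF TZ_ideal_TZ_V1])

lemma subspace_TZ_V1: "free.subspace TZ_V1"
  by (rule free.subspaceI)
    (simp_all add: free_scale_eq_mult two_sided_idealD[OF two_sided_ideal_TZ_V1])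

lemma commutator_add:
  "commutator (a + b) c = commutator a c + commutator b c"
  "commutator c (a + b) = commutator c a + commutator c b"
  by (simp_all add: commutator_def algebra_simps)

lemma commutator_0 [simp]: "commutator 0 c = 0" "commutator c 0 = 0"
  by (simp_all add: commutator_def)

lemma (in assoc_algebra) commutator_scale:
  "commutator (scale r a) c = scale r (commutator a c)"
  "commutator c (scale r a) = scale r (commutator c a)"
  by (simp_all add: commutator_def scale_mult_left scale_mult_right scale_right_diff_distrib)

text \<open>
  The triple commutator is trilinear.
\<close>

lemma (in assoc_algebra) triple_commutator_in_subspace:
  assumes "subspace W" and "span B = UNIV"
    and B: "\<And>a b c. a \<in> B \<Longrightarrow> b \<in> B \<Longrightarrow> c \<in> B \<Longrightarrow> commutator (commutator a b) c \<in> W"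
  shows "commutator (commutator a b) c \<in> W"
proof -
  note W = subspace_0[OF \<open>subspace W\<close>] subspace_add[OF \<open>subspace W\<close>] subspace_scale[OF \<open>subspace W\<close>]
  have span: "x \<in> span B" for x using assms(2) by simp
  have 1: "commutator (commutator a b) c \<in> W" if "a \<in> B" "b \<in> B" for a b
    using span[of c] by (induction rule: span_induct_alt)
      (auto simp: commutator_add commutator_scale that intro!: W B)
  have 2: "commutator (commutator a b) c \<in> W" if "a \<in> B" for a
    using span[of b] by (induction rule: span_induct_alt)
      (auto simp: commutator_add commutator_scale that intro!: W 1)
  show ?thesis
    using span[of a] by (induction rule: span_induct_alt)
      (auto simp: commutator_add commutator_scale intro!: W 2)
qed

text \<open>
  Only variables occur in the generators of the ideal. Since words are homogeneous, any three of them are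
  the images of three variables of the right degrees under an endomorphism, and words span
  the free algebra.
\<close>

lemma triple_commutator_in_TZ_V1: "commutator (commutator f g) h \<in> TZ_V1"
proof (rule free.triple_commutator_in_subspace[OF subspace_TZ_V1 span_words])
  fix f g h :: "'a free_algebra" assume "f \<in> range word" "g \<in> range word" "h \<in> range word"
  then obtain u v w where fgh: "f = word u" "g = word v" "h = word w" by blast
  define i j k where ijk: "i = sum_list (map var_degree u)" "j = sum_list (map var_degree v)"
    "k = sum_list (map var_degree w)"
  define \<phi> where "\<phi> x = (if x = GVar i 1 then f else if x = GVar j 2 then g
    else if x = GVar k 3 then h else word [x])" for x
  have \<phi>: "\<phi> x \<in> free_component (var_degree x)" for x
    using word_in_free_component[of "[x]", where ?'a = 'a]
    by (auto simp: \<phi>_def fgh ijk word_in_free_component)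
  let ?g = "commutator (commutator (word [GVar i 1]) (word [GVar j 2])) (word [GVar k 3])"
  have "?g \<in> (TZ_V1 :: 'a free_algebra set)"
    unfolding TZ_V1_def TZ_ideal_generated_def by blast
  then have "free_eval free_scale \<phi> ?g \<in> TZ_V1"
    by (rule TZ_ideal_endomorphism[OF TZ_ideal_TZ_V1 graded_endomorphism_free_eval[OF \<phi>]])
  then show "commutator (commutator f g) h \<in> TZ_V1"
    by (simp add: free.free_eval_commutator free.free_eval_word \<phi>_def)
qed

section \<open>Normal forms modulo the triple commutators\<close>

text \<open>
  The value 0 on lists of odd length makes exchanging two neighbouring entries change the
  sign, modulo triple commutators, for all lists alike, whatever the parity of their positions.
\<close>

fun comm_prod :: "'a::ring_1 list \<Rightarrow> 'a" where
  "comm_prod [] = 1"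
| "comm_prod [a] = 0"
| "comm_prod (a # b # xs) = commutator a b * comm_prod xs"

lemma comm_prod_odd: "odd (length xs) \<Longrightarrow> comm_prod xs = 0"
  by (induction xs rule: comm_prod.induct) auto

text \<open>
  The entries of one commutator can be exchanged by antisymmetry. For neighbours in two consecutive
  commutators, the reason is the derivation rule: expanding \<open>[[c d, b], a]\<close> gives
  \<open>[c, a][d, b] + [c, b][d, a]\<close> up to terms that contain a triple commutator.
\<close>

lemma comm_prod_swap:
  assumes I: "two_sided_ideal I" and triple: "\<And>a b c. commutator (commutator a b) c \<in> I"
  shows "comm_prod (xs @ a # b # ys) + comm_prod (xs @ b # a # ys) \<in> I"
proof (induction xs rule: comm_prod.induct)
  case 1
  have "comm_prod ([] @ a # b # ys) + comm_prod ([] @ b # a # ys) = 0"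
    by (simp add: commutator_def algebra_simps)
  then show ?case by (simp add: two_sided_idealD[OF I])
next
  case (2 c)
  show ?case
  proof (cases ys)
    case Nil
    then show ?thesis by (simp add: two_sided_idealD[OF I])
  next
    case (Cons d zs)
    \<comment> \<open>Here \<open>a\<close> is the second entry of one commutator and \<open>b\<close> the first entry of the next.\<close>
    have "commutator c a * commutator b d + commutator c b * commutator a d =
        c * commutator (commutator d b) a + commutator (commutator c b) a * d
        - commutator (commutator (c * d) b) a"
      by (simp add: commutator_def algebra_simps)
    moreover have "\<dots> \<in> I"
      by (intro two_sided_ideal_diff[OF I] two_sided_ideal_add[OF I] two_sided_ideal_mult_left[OF I triple]
          two_sided_ideal_mult_right[OF I triple] triple)
    ultimately have "(commutator c a * commutator b d + commutator c b * commutator a d) * comm_prod zs \<in> I"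
      by (simp only: two_sided_ideal_mult_right[OF I])
    then show ?thesis by (simp add: Cons distrib_right mult.assoc)
  qed
next
  case (3 c d xs)
  then have "commutator c d * (comm_prod (xs @ a # b # ys) + comm_prod (xs @ b # a # ys)) \<in> I"
    by (rule two_sided_ideal_mult_left[OF I])
  then show ?case by (simp add: distrib_left)
qed

lemma mset_swap_induct:
  assumes swap: "\<And>p a b q. Q (p @ a # b # q) \<Longrightarrow> Q (p @ b # a # q)"
    and "mset xs = mset ys" "Q xs"
  shows "Q ys"
proof -
  \<comment> \<open>A single entry can be moved to the right past any block.\<close>
  have move: "Q (p @ a # y1 @ y2) \<Longrightarrow> Q (p @ y1 @ a # y2)" for p a y1 y2
  proof (induction y1 arbitrary: p)
    case (Cons b y1)
    then show ?case using swap[of p a b "y1 @ y2"] Cons.IH[of "p @ [b]"] by simp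
  qed simp
  have "mset xs = mset ys \<Longrightarrow> Q (p @ xs) \<Longrightarrow> Q (p @ ys)" for p
  proof (induction xs arbitrary: p ys)
    case (Cons a xs)
    then have "a \<in> set ys" by (metis list.set_intros(1) mset_eq_setD)
    then obtain y1 y2 where ys: "ys = y1 @ a # y2" by (meson split_list)
    with Cons show ?case using Cons.IH[of "y1 @ y2" "p @ [a]"] move[of p a y1 y2] by simp
  qed simp
  from this[of "[]"] assms(2,3) show ?thesis by simp
qed

text \<open>
  A choice of one arrangement for every multiset. It replaces an ordering of the variables.
\<close>

definition canonical :: "'a list \<Rightarrow> bool" where
  "canonical xs \<longleftrightarrow> xs = (SOME ys. mset ys = mset xs)"

lemma canonical_unique: "canonical xs \<Longrightarrow> canonical ys \<Longrightarrow> mset xs = mset ys \<Longrightarrow> xs = ys"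
  by (simp add: canonical_def)

lemma canonical_exists: obtains ys where "canonical ys" "mset ys = mset xs"
proof -
  let ?ys = "SOME ys. mset ys = mset xs"
  have "mset ?ys = mset xs" by (rule someI) simp
  with that[of ?ys] show thesis by (simp add: canonical_def)
qed

definition normal_form :: "gvar list \<Rightarrow> gvar list \<Rightarrow> 'f::field free_algebra" where
  "normal_form us vs = word us * comm_prod (map (\<lambda>x. word [x]) vs)"

lemma (in assoc_algebra) free_eval_normal_form:
  "free_eval scale \<phi> (normal_form us vs) = prod_list (map \<phi> us) * comm_prod (map \<phi> vs)"
proof -
  have "free_eval scale \<phi> (comm_prod (map (\<lambda>x. word [x]) vs)) = comm_prod (map \<phi> vs)"
    by (induction vs rule: induct_list012)
      (simp_all add: free_eval_one free_eval_mult free_eval_commutator free_eval_word)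
  then show ?thesis by (simp add: normal_form_def free_eval_mult free_eval_word)
qed

definition normal_index :: "(gvar list \<times> gvar list) set" where
  "normal_index = {(us, vs). canonical us \<and> canonical vs \<and> distinct vs \<and> even (length vs)}"

text \<open>
  Two neighbouring variables \<open>a\<close>, \<open>b\<close> in front of the commutators can be exchanged at the cost of a
  term in which \<open>[a, b]\<close>, being central modulo \<open>I\<close>, has joined the commutators; that term has a shorter
  word in front, so induction on its length applies. Within the commutators, exchanges
  only change the sign, and a repeated variable can be moved into a commutator \<open>[a, a] = 0\<close>.
\<close>

lemma span_normal_forms:
  fixes I :: "'f::field free_algebra set"
  assumes I: "two_sided_ideal I" and triple: "\<And>a b c. commutator (commutator a b) c \<in> I"
  shows "free.span ((\<lambda>(us, vs). normal_form us vs) ` normal_index \<union> I) = UNIV"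
proof -
  define W where "W = free.span ((\<lambda>(us, vs). normal_form us vs :: 'f free_algebra) ` normal_index \<union> I)"
  have IW: "f \<in> I \<Longrightarrow> f \<in> W" for f
    by (simp add: W_def free.span_base)
  have W: "0 \<in> W" "f \<in> W \<Longrightarrow> g \<in> W \<Longrightarrow> f + g \<in> W" "f \<in> W \<Longrightarrow> g \<in> W \<Longrightarrow> f - g \<in> W" for f g
    by (auto simp: W_def free.span_zero intro: free.span_add free.span_diff)
  have "normal_form us vs \<in> W" for us vs
  proof (induction "length us" arbitrary: us vs rule: less_induct)
    case less
    have swap_vs: "normal_form us' (p @ b # a # q) \<in> W" if "normal_form us' (p @ a # b # q) \<in> W"
      for us' p a b q
    proof -
      let ?x = "\<lambda>x. word [x] :: 'f free_algebra"
      have "comm_prod (map ?x p @ ?x a # ?x b # map ?x q) +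
          comm_prod (map ?x p @ ?x b # ?x a # map ?x q) \<in> I"
        by (rule comm_prod_swap[OF I triple])
      then have "normal_form us' (p @ a # b # q) + normal_form us' (p @ b # a # q) \<in> I"
        unfolding normal_form_def distrib_left[symmetric]
        by (auto intro: two_sided_ideal_mult_left[OF I])
      from W(3)[OF IW[OF this] that] show ?thesis by simp
    qed
    have canonical_us: "normal_form us' vs \<in> W" if "canonical us'" for us'
    proof -
      obtain vs' where vs': "canonical vs'" "mset vs' = mset vs" by (rule canonical_exists)
      have "normal_form us' vs' \<in> W"
      proof -
        consider "odd (length vs')" | "\<not> distinct vs'" | "even (length vs')" "distinct vs'" by blast
        then show ?thesis
        proof cases
          case 1
          then show ?thesis by (simp add: normal_form_def comm_prod_odd W)
        next
          case 2
          then obtain p q r a where vs'_eq: "vs' = p @ [a] @ q @ [a] @ r"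
            by (meson not_distinct_decomp)
          have "normal_form us' (a # a # p @ q @ r) \<in> W"
            by (simp add: normal_form_def commutator_def W)
          show ?thesis
          proof (rule mset_swap_induct[where Q = "\<lambda>vs. normal_form us' vs \<in> W"])
            show "mset (a # a # p @ q @ r) = mset vs'" by (simp add: vs'_eq)
          qed (erule swap_vs, fact)
        next
          case 3
          then show ?thesis
            using that vs' unfolding W_def
            by (intro free.span_base) (force simp: normal_index_def)
        qed
      qed
      from _ vs'(2) this show ?thesis
        by (rule mset_swap_induct[where Q = "\<lambda>vs. normal_form us' vs \<in> W"]) (erule swap_vs)
    qed
    have swap_us: "length (p @ b # a # q) = length us \<longrightarrow> normal_form (p @ b # a # q) vs \<in> W"
      if "length (p @ a # b # q) = length us \<longrightarrow> normal_form (p @ a # b # q) vs \<in> W"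
      for p a b q
    proof
      assume len: "length (p @ b # a # q) = length us"
      let ?A = "word [a] :: 'f free_algebra" and ?B = "word [b] :: 'f free_algebra"
        and ?P = "word p :: 'f free_algebra" and ?R = "word q :: 'f free_algebra"
        and ?C = "comm_prod (map (\<lambda>x. word [x]) vs) :: 'f free_algebra"
      have split: "word (p @ x # y # q) = ?P * word [x] * word [y] * ?R" for x y
        using word_append[of p "[x] @ [y] @ q", where ?'a = 'f] word_append[of "[x]" "[y] @ q", where ?'a = 'f]
          word_append[of "[y]" q, where ?'a = 'f]
        by (simp only: append.simps mult.assoc)
      \<comment> \<open>The term that appears when \<open>a\<close> and \<open>b\<close> are exchanged and \<open>[a, b]\<close> moves to the right of \<open>q\<close>.\<close>
      have "normal_form (p @ q) (a # b # vs) \<in> W"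
        using len by (intro less) auto
      moreover have "normal_form (p @ q) (a # b # vs) = ?P * ?R * commutator ?A ?B * ?C"
        unfolding normal_form_def word_append by (simp only: mult.assoc comm_prod.simps list.map)
      moreover have "?P * commutator (commutator ?A ?B) ?R * ?C \<in> W"
        by (intro IW two_sided_ideal_mult_right[OF I] two_sided_ideal_mult_left[OF I] triple)
      moreover have "normal_form (p @ a # b # q) vs \<in> W" using that len by simp
      moreover have "normal_form (p @ b # a # q) vs =
          normal_form (p @ a # b # q) vs - ?P * ?R * commutator ?A ?B * ?C
            - ?P * commutator (commutator ?A ?B) ?R * ?C"
        unfolding normal_form_def split commutator_def
        by (simp add: algebra_simps del: mult_single)
      ultimately show "normal_form (p @ b # a # q) vs \<in> W" by (simp only: W)
    qed
    obtain us' where us': "canonical us'" "mset us' = mset us" by (rule canonical_exists)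
    from us'(1) have "length us' = length us \<longrightarrow> normal_form us' vs \<in> W"
      using canonical_us by blast
    from _ us'(2) this have "length us = length us \<longrightarrow> normal_form us vs \<in> W"
      by (rule mset_swap_induct[where Q = "\<lambda>xs. length xs = length us \<longrightarrow> normal_form xs vs \<in> W"])
        (rule swap_us)
    then show ?case by simp
  qed
  from this[of _ "[]"] have "range word \<subseteq> W" by (auto simp: normal_form_def)
  then have "free.span (range word) \<subseteq> W"
    unfolding W_def by (simp add: free.span_minimal)
  then show ?thesis using span_words W_def by blast
qed

section \<open>Sums of central elements of square zero and of anticommuting elements\<close>

definition central :: "'a::ring_1 \<Rightarrow> bool" where
  "central a \<longleftrightarrow> (\<forall>b. a * b = b * a)"

lemma centralD: "central a \<Longrightarrow> a * b = b * a"
  by (simp add: central_def)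

text \<open>
  The list of pairs attaches a variable to each of finitely many ring elements, and the variable \<open>x\<close> is
  sent to the sum of the elements attached to it.
\<close>

fun fibre_sum :: "('x \<times> 'a::ring_1) list \<Rightarrow> 'x \<Rightarrow> 'a" where
  "fibre_sum [] x = 0"
| "fibre_sum ((y, b) # zs) x = (if x = y then b else 0) + fibre_sum zs x"

lemma central_0: "central 0" by (simp add: central_def)

lemma central_add: "central a \<Longrightarrow> central b \<Longrightarrow> central (a + b)"
  by (simp add: central_def distrib_left distrib_right)

lemma central_mult:
  assumes "central a" "central b"
  shows "central (a * b)"
  unfolding central_def
proof
  fix c
  have "a * b * c = a * (c * b)" using centralD[OF assms(2), of c] by (simp add: mult.assoc)
  also have "\<dots> = c * (a * b)" using centralD[OF assms(1), of c] by (simp add: mult.assoc[symmetric])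
  finally show "a * b * c = c * (a * b)" .
qed

lemma central_prod_list:
  assumes "\<And>x. x \<in> set xs \<Longrightarrow> central (f x)"
  shows "central (prod_list (map f xs))"
  using assms
proof (induction xs)
  case (Cons x xs)
  then show ?case by (simp add: central_mult)
qed (simp add: central_def)

lemma central_fibre_sum: "(\<And>p. p \<in> set zs \<Longrightarrow> central (snd p)) \<Longrightarrow> central (fibre_sum zs x)"
proof (induction zs x rule: fibre_sum.induct)
  case (2 y b zs x)
  then have "central b" "central (fibre_sum zs x)" by force+
  then show ?case by (auto simp: central_add)
qed (simp add: central_0)

lemma prod_list_remove1:
  assumes "\<And>x. central (f x)" "y \<in> set us"
  shows "f y * prod_list (map f (remove1 y us)) = prod_list (map f us)"
  using assms(2)
proof (induction us)
  case (Cons u us)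
  show ?case
  proof (cases "u = y")
    case False
    have "f y * (f u * prod_list (map f (remove1 y us))) = f u * (f y * prod_list (map f (remove1 y us)))"
      using centralD[OF assms(1), of y "f u"] by (simp only: mult.assoc[symmetric])
    then show ?thesis using False Cons by simp
  qed simp
qed simp

lemma of_nat_mult_swap:
  fixes a b :: "'a::ring_1"
  shows "of_nat k * a * (of_nat l * b) = of_nat (k * l) * (a * b)"
proof -
  have "of_nat k * a * (of_nat l * b) = of_nat k * (a * of_nat l) * b" by (simp only: mult.assoc)
  also have "\<dots> = of_nat k * (of_nat l * a) * b" by (simp only: mult_of_nat_commute[of l a])
  finally show ?thesis by (simp add: mult.assoc)
qed

text \<open>
  Since \<open>b\<^sup>2 = 0\<close>, at most one of the factors indexed by \<open>y\<close> can contribute \<open>b\<close>, and by commutativity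
  it does not matter which one.
\<close>

lemma prod_fibre_sum_Cons:
  fixes zs :: "('x \<times> 'a::ring_1) list" and y :: 'x
  assumes zs: "\<And>p. p \<in> set zs \<Longrightarrow> central (snd p)" and b: "central b" "b * b = 0"
  defines "F \<equiv> fibre_sum ((y, b) # zs)"
  shows "prod_list (map F us) = prod_list (map (fibre_sum zs) us)
    + of_nat (count (mset us) y) * b * prod_list (map (fibre_sum zs) (remove1 y us))"
proof (induction us)
  case (Cons u us)
  let ?s = "fibre_sum zs" and ?c = "of_nat (count (mset us) y) :: 'a"
  let ?P = "prod_list (map ?s us)" and ?R = "prod_list (map ?s (remove1 y us))"
  have F: "F x = (if x = y then b else 0) + ?s x" for x by (simp add: F_def)
  have s: "central (?s x)" for x
    by (rule central_fibre_sum) (rule zs)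
  have comm: "?s x * (?c * b * r) = ?c * b * (?s x * r)" for x r
  proof -
    have "?s x * (?c * b * r) = ?c * b * (r * ?s x)"
      using centralD[OF s, of x "?c * b * r"] by (simp only: mult.assoc)
    also have "r * ?s x = ?s x * r" by (rule centralD[OF s, symmetric])
    finally show ?thesis .
  qed
  have step: "prod_list (map F (u # us)) = F u * (?P + ?c * b * ?R)"
    using Cons.IH by simp
  show ?case
  proof (cases "u = y")
    case True
    have R: "?c * b * (?s y * ?R) = ?c * b * ?P"
    proof (cases "y \<in> set us")
      case True
      then show ?thesis by (simp only: prod_list_remove1[of ?s, OF s])
    next
      case False
      then have "count (mset us) y = 0" by simp
      then show ?thesis by (simp only: of_nat_0 mult_zero_left)
    qed
    have "b * (b * ?R) = 0" by (simp add: mult.assoc[symmetric] b(2))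
    then have bb: "b * (?c * b * ?R) = 0"
      using of_nat_mult_swap[of 1 b "count (mset us) y" "b * ?R"] by (simp add: mult.assoc)
    have "F u = b + ?s y" using True by (simp add: F)
    then have "F u * (?P + ?c * b * ?R) = ?s y * ?P + (b * ?P + ?c * b * ?P)"
      by (simp only: distrib_left distrib_right bb comm R add_0_left add.assoc add.left_commute)
    then show ?thesis
      unfolding step using True by (simp add: distrib_right)
  next
    case False
    then show ?thesis unfolding step by (simp add: F distrib_left comm)
  qed
qed simp

text \<open>
  A product of sums of commuting elements of square zero is the sum over all ways of selecting distinct
  elements, one from each factor. With at least as many factors as elements, every element must be
  selected, so the indices of the factors have to match those of the elements; the constant \<open>c\<close> counts
  the selections.
\<close>

lemma prod_fibre_sum:
  fixes zs :: "('x \<times> 'a::ring_1) list"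
  assumes "\<And>p. p \<in> set zs \<Longrightarrow> central (snd p) \<and> snd p * snd p = 0"
  shows "\<exists>c>0. \<forall>us. length us \<ge> length zs \<longrightarrow>
    prod_list (map (fibre_sum zs) us) =
    (if mset us = mset (map fst zs) then of_nat c * prod_list (map snd zs) else 0)"
  using assms
proof (induction zs)
  case Nil
  have *: "prod_list (map (fibre_sum []) us) = (if us = [] then 1 else 0 :: 'a)" for us :: "'x list"
    by (cases us) auto
  show ?case unfolding * by (intro exI[of _ 1]) simp
next
  case (Cons p zs)
  obtain y b where p: "p = (y, b)" by fastforce
  obtain c where c: "c > 0" "\<And>us. length us \<ge> length zs \<Longrightarrow>
    prod_list (map (fibre_sum zs) us) =
    (if mset us = mset (map fst zs) then of_nat c * prod_list (map snd zs) else 0)"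
    using Cons.IH Cons.prems by (auto simp del: fibre_sum.simps)
  have b: "central b" "b * b = 0" and zs: "\<And>p. p \<in> set zs \<Longrightarrow> central (snd p)"
    using Cons.prems[of p] Cons.prems by (simp_all add: p)
  let ?d = "Suc (count (mset (map fst zs)) y)"
  show ?case
  proof (intro exI conjI allI impI)
    show "0 < ?d * c" using c by simp
    fix us :: "'x list" assume len: "length (p # zs) \<le> length us"
    have 0: "prod_list (map (fibre_sum zs) us) = 0"
    proof -
      have "mset us \<noteq> mset (map fst zs)" using len by (auto dest: arg_cong[of _ _ size])
      then show ?thesis using len c(2)[of us] by simp
    qed
    have "prod_list (map (fibre_sum (p # zs)) us) = prod_list (map (fibre_sum zs) us) +
      of_nat (count (mset us) y) * b * prod_list (map (fibre_sum zs) (remove1 y us))"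
      unfolding p by (rule prod_fibre_sum_Cons) (fact zs b)+
    then have eq: "prod_list (map (fibre_sum (p # zs)) us) =
      of_nat (count (mset us) y) * b * prod_list (map (fibre_sum zs) (remove1 y us))"
      unfolding 0 by (simp only: add_0_left)
    show "prod_list (map (fibre_sum (p # zs)) us) =
      (if mset us = mset (map fst (p # zs)) then of_nat (?d * c) * prod_list (map snd (p # zs)) else 0)"
    proof (cases "y \<in> set us")
      case True
      define us' where "us' = remove1 y us"
      have us: "mset us = add_mset y (mset us')" using True by (simp add: us'_def)
      have "length zs \<le> length us'" using len True by (simp add: us'_def length_remove1)
      note IH = c(2)[OF this]
      show ?thesis
      proof (cases "mset us' = mset (map fst zs)")
        case eqz: True
        then have mset_us: "mset us = mset (map fst (p # zs))" using us by (simp add: p)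
        moreover have "count (mset us) y = ?d" unfolding mset_us by (simp add: p)
        moreover have "of_nat ?d * b * (of_nat c * prod_list (map snd zs)) =
            of_nat (?d * c) * (b * prod_list (map snd zs))"
          by (rule of_nat_mult_swap)
        ultimately show ?thesis using eqz unfolding eq us'_def[symmetric] IH by (simp only: if_True simp_thms p list.map prod_list.Cons snd_conv)
      next
        case False
        then have "mset us \<noteq> mset (map fst (p # zs))" using us by (simp add: p)
        then show ?thesis using False unfolding eq us'_def[symmetric] IH by simp
      qed
    next
      case False
      have "mset us \<noteq> mset (map fst (p # zs))"
      proof
        assume "mset us = mset (map fst (p # zs))"
        then have "set us = set (map fst (p # zs))" by (rule mset_eq_setD)
        with False show False by (simp add: p)
      qed
      moreover have "count (mset us) y = 0" using False by simp
      ultimately show ?thesis unfolding eq by (simp only: of_nat_0 mult_zero_left if_False)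
    qed
  qed
qed

lemma anticommuting_mult_prod_list:
  fixes e :: "'x \<Rightarrow> 'a::ring_1"
  assumes anti: "\<And>x y. e x * e y = - (e y * e x)" and sq: "\<And>x. e x * e x = 0" and "u \<in> set vs"
  shows "e u * prod_list (map e vs) = 0"
  using assms(3)
proof (induction vs)
  case (Cons v vs)
  show ?case
  proof (cases "u = v")
    case True
    then show ?thesis using sq by (simp add: mult.assoc[symmetric])
  next
    case False
    have "e u * (e v * prod_list (map e vs)) = - (e v * (e u * prod_list (map e vs)))"
      using anti[of u v] by (simp add: mult.assoc[symmetric])
    then show ?thesis using False Cons by simp
  qed
qed simp

text \<open>
  Central summands do not contribute to commutators, and \<open>[e\<^sub>a, e\<^sub>b] = 2 e\<^sub>a e\<^sub>b\<close> for anticommuting elements.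
\<close>

lemma comm_prod_central_plus_odd:
  fixes t e :: "'x \<Rightarrow> 'a::ring_1"
  assumes t: "\<And>x. central (t x)" and anti: "\<And>x y. e x * e y = - (e y * e x)" and "even (length vs)"
  shows "comm_prod (map (\<lambda>x. t x + e x) vs) = of_nat (2 ^ (length vs div 2)) * prod_list (map e vs)"
  using assms(3)
proof (induction vs rule: induct_list012)
  case (3 a b vs)
  have "commutator (t a + e a) (t b + e b) = e a * e b - e b * e a"
    using centralD[OF t, of a "t b"] centralD[OF t, of a "e b"] centralD[OF t, of b "e a"]
    by (simp add: commutator_def algebra_simps)
  also have "\<dots> = of_nat 2 * (e a * e b)"
    using anti[of b a] by (simp add: mult_2)
  finally have "comm_prod (map (\<lambda>x. t x + e x) (a # b # vs)) =
      of_nat 2 * (e a * e b) * (of_nat (2 ^ (length vs div 2)) * prod_list (map e vs))"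
    using 3 by simp
  also have "\<dots> = of_nat (2 * 2 ^ (length vs div 2)) * (e a * (e b * prod_list (map e vs)))"
    by (simp only: of_nat_mult_swap) (simp only: mult.assoc)
  finally show ?case by simp
qed auto

lemma prod_list_central_plus_annihilator:
  fixes t e :: "'x \<Rightarrow> 'a::ring_1"
  assumes t: "\<And>x. central (t x)" and "\<And>x. e x * y = 0"
  shows "prod_list (map (\<lambda>x. t x + e x) us) * y = prod_list (map t us) * y"
proof (induction us)
  case (Cons u us)
  have "e u * (prod_list (map t us) * y) = prod_list (map t us) * (e u * y)"
    by (simp only: mult.assoc[symmetric] centralD[OF central_prod_list[of us t, OF t], of "e u"])
  then show ?case by (simp add: mult.assoc Cons.IH distrib_right assms(2))
qed simp

section \<open>The Grassmann algebra as a graded algebra\<close>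

global_interpretation grassmann: assoc_algebra grassmann_scale
  by unfold_locales (rule grassmann_scale_mult_left grassmann_scale_mult_right)+

lemma grassmann_basis_empty: "grassmann_basis {} = 1"
  using grassmann_basis_eq_prod_list[of "[]"] by simp

lemma span_grassmann_basis:
  "grassmann.span {grassmann_basis S | S. finite S} = (UNIV :: 'f::field grassmann set)"
proof -
  have "a \<in> grassmann.span {grassmann_basis S | S. finite S}" for a :: "'f grassmann"
  proof -
    let ?supp = "{S. coord a S \<noteq> 0}"
    have fin: "finite ?supp" "\<And>S. S \<in> ?supp \<Longrightarrow> finite S"
      using coord[of a] by auto
    have "coord (\<Sum>S\<in>B. f S) R = (\<Sum>S\<in>B. coord (f S) R)" for B R and f :: "nat set \<Rightarrow> 'f grassmann"
      by (induction B rule: infinite_finite_induct) (simp_all add: zero_grassmann.rep_eq plus_grassmann.rep_eq)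
    then have "coord (\<Sum>S\<in>?supp. grassmann_scale (coord a S) (grassmann_basis S)) R =
        (\<Sum>S\<in>?supp. if R = S then coord a R else 0)" for R
      using fin(2) by (auto simp: grassmann_scale.rep_eq grassmann_basis.rep_eq intro!: sum.cong)
    then have "a = (\<Sum>S\<in>?supp. grassmann_scale (coord a S) (grassmann_basis S))"
      by (intro coord_inject[THEN iffD1] ext) (simp add: fin(1))
    also have "\<dots> \<in> grassmann.span {grassmann_basis S | S. finite S}"
      by (intro grassmann.span_sum grassmann.span_scale grassmann.span_base) (use fin(2) in auto)
    finally show ?thesis .
  qed
  then show ?thesis by blast
qed

text \<open>
  Every pair in \<open>S \<times> T\<close> is inverted in exactly one of the two orders.
\<close>

lemma shuffle_sign_swap:
  assumes "finite S" "finite T" "S \<inter> T = {}"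
  shows "shuffle_sign S T * shuffle_sign T S = ((- 1) ^ (card S * card T) :: 'f::comm_ring_1)"
proof -
  let ?P = "\<lambda>A B. {(s::nat, t). s \<in> A \<and> t \<in> B \<and> t < s}"
  have fin: "finite (?P A B)" if "finite A" "finite B" for A B
    by (rule finite_subset[of _ "A \<times> B"]) (use that in auto)
  have "S \<times> T = ?P S T \<union> prod.swap ` ?P T S"
    using assms(3) by (force simp: image_iff)
  then have "card (S \<times> T) = card (?P S T \<union> prod.swap ` ?P T S)" by simp
  also have "\<dots> = card (?P S T) + card (prod.swap ` ?P T S)"
    by (intro card_Un_disjoint) (use assms fin in auto)
  also have "card (prod.swap ` ?P T S) = card (?P T S)"
    by (rule card_image) simp
  finally show ?thesis
    by (simp add: shuffle_sign_def card_cartesian_product power_add)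
qed

lemma shuffle_sign_square: "shuffle_sign S T * shuffle_sign S T = (1 :: 'f::ring_1)"
  unfolding shuffle_sign_def by (simp add: power_add[symmetric] mult_2[symmetric])

lemma grassmann_basis_commute:
  assumes "finite S" "finite T"
  shows "grassmann_basis S * grassmann_basis T =
    grassmann_scale ((- 1) ^ (card S * card T)) (grassmann_basis T * grassmann_basis S :: 'f::field grassmann)"
proof (cases "S \<inter> T = {}")
  case True
  have "shuffle_sign S T = (- 1) ^ (card S * card T) * (shuffle_sign T S :: 'f)"
    using shuffle_sign_swap[OF assms True, where ?'f = 'f]
    by (metis mult.assoc mult.right_neutral shuffle_sign_square)
  then show ?thesis
    using assms True by (simp add: grassmann_basis_mult Int_commute Un_commute)
qed (use assms in \<open>auto simp: grassmann_basis_mult Int_commute\<close>)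

lemma even_grassmann_basis_central:
  assumes "finite S" "even (card S)"
  shows "central (grassmann_basis S :: 'f::field grassmann)"
  unfolding central_def
proof
  fix b :: "'f grassmann"
  have "b \<in> grassmann.span {grassmann_basis S | S. finite S}" by (simp add: span_grassmann_basis)
  then show "grassmann_basis S * b = b * grassmann_basis S"
  proof (induction rule: grassmann.span_induct_alt)
    case (step c x y)
    then obtain T where T: "x = grassmann_basis T" "finite T" by blast
    then have "grassmann_basis S * x = x * grassmann_basis S"
      using grassmann_basis_commute[OF assms(1) T(2), where ?'f = 'f] assms(2) by simp
    with step show ?case
      by (simp add: distrib_left distrib_right grassmann_scale_mult_left grassmann_scale_mult_right)
  qed simp
qed

lemma odd_grassmann_basis_anticommute:
  assumes "finite S" "odd (card S)" "finite T" "odd (card T)"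
  shows "grassmann_basis S * grassmann_basis T = - (grassmann_basis T * grassmann_basis S :: 'f::field grassmann)"
  using grassmann_basis_commute[OF assms(1,3), where ?'f = 'f] assms(2,4)
  by (simp add: grassmann.scale_minus_left)

lemma grassmann_triple_commutator: "commutator (commutator a b) c = (0 :: 'f::field grassmann)"
proof -
  have "commutator (commutator a b) c \<in> ({0} :: 'f grassmann set)"
  proof (rule grassmann.triple_commutator_in_subspace[OF _ span_grassmann_basis])
    fix a b c :: "'f grassmann"
    assume "a \<in> {grassmann_basis S | S. finite S}" "b \<in> {grassmann_basis S | S. finite S}"
    then obtain S T where ST: "a = grassmann_basis S" "b = grassmann_basis T" "finite S" "finite T"
      by blast
    consider "central a" | "central b" | "odd (card S)" "odd (card T)"
      using ST even_grassmann_basis_central by blast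
    then have "central (commutator a b)"
    proof cases
      case 3
      then have comm: "commutator a b = a * b + a * b"
        unfolding commutator_def ST using odd_grassmann_basis_anticommute[OF ST(4) _ ST(3), where ?'f = 'f]
        by simp
      have "central (a * b)"
      proof (cases "S \<inter> T = {}")
        case True
        then have "even (card (S \<union> T))" using 3 ST by (simp add: card_Un_disjoint)
        then have "central (grassmann_basis (S \<union> T) :: 'f grassmann)"
          using ST by (intro even_grassmann_basis_central) auto
        then show ?thesis
          using ST True by (simp add: grassmann_basis_mult central_def
              grassmann_scale_mult_left grassmann_scale_mult_right)
      qed (use ST in \<open>auto simp: grassmann_basis_mult central_def\<close>)
      then show ?thesis unfolding comm central_def by (simp add: distrib_left distrib_right)
    qed (auto simp: commutator_def central_def)
    then show "commutator (commutator a b) c \<in> {0}" by (simp add: commutator_def central_def)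
  qed simp
  then show ?thesis by simp
qed

lemma graded_algebra_grassmann:
  "graded_algebra grassmann_scale (grassmann_component m n J :: int \<Rightarrow> 'f::field grassmann set)"
proof unfold_locales
  show "grassmann.subspace (grassmann_component m n J r :: 'f grassmann set)" for r
    unfolding grassmann_component_def by simp
  show "(1 :: 'f grassmann) \<in> grassmann_component m n J 0"
    unfolding grassmann_component_def
    by (rule grassmann.span_base) (force simp: grassmann_basis_empty basis_degree_def)
  fix r s :: int and a b :: "'f grassmann"
  assume "a \<in> grassmann_component m n J r" "b \<in> grassmann_component m n J s"
  then show "a * b \<in> grassmann_component m n J (r + s)"
    unfolding grassmann_component_def
  proof (rule grassmann.span_mult)
    fix p q :: "'f grassmann"
    let ?B = "{grassmann_basis S |S. finite S \<and> basis_degree m n J S = r + s} :: 'f grassmann set"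
    assume "p \<in> {grassmann_basis S | S. finite S \<and> basis_degree m n J S = r}"
      "q \<in> {grassmann_basis S | S. finite S \<and> basis_degree m n J S = s}"
    then obtain S T where ST: "p = grassmann_basis S" "q = grassmann_basis T" "finite S" "finite T"
      "basis_degree m n J S = r" "basis_degree m n J T = s" by blast
    show "p * q \<in> grassmann.span ?B"
    proof (cases "S \<inter> T = {}")
      case True
      then have "basis_degree m n J (S \<union> T) = r + s"
        using ST unfolding basis_degree_def by (simp add: sum.union_disjoint)
      then have "grassmann_basis (S \<union> T) \<in> ?B" using ST by blast
      then show ?thesis
        using ST True by (simp add: grassmann_basis_mult grassmann.span_scale grassmann.span_base)
    qed (use ST in \<open>simp add: grassmann_basis_mult grassmann.span_zero\<close>)
  qed
qed

section \<open>Monomials of prescribed degree and parity\<close>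

text \<open>
  Let \<open>(a, b)\<close> be an integer solution of \<open>a m + b n = d\<close>. Adding multiples of \<open>(n, - m)\<close> makes it positive,
  and one further step changes the parity of \<open>a + b\<close> because \<open>n - m\<close> is odd. The two infinite supplies of
  generators then provide a monomial with \<open>a\<close> factors of degree \<open>m\<close> and \<open>b\<close> factors of degree \<open>n\<close>.
\<close>

lemma exists_monomial_of_degree_and_parity:
  fixes m n d :: int
  assumes "m < 0" "0 < n" "gcd m n = 1" "infinite J" "infinite (- J)" "odd (n - m)" "finite X"
  shows "\<exists>S. finite S \<and> S \<noteq> {} \<and> S \<inter> X = {} \<and> basis_degree m n J S = d \<and> (even (card S) \<longleftrightarrow> q)"
proof -
  obtain u v where uv: "u * m + v * n = 1"
    using bezout_int[of m n] assms(3) by auto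
  define a where "a k = d * u + k * n" for k
  define b where "b k = d * v - k * m" for k
  have deg: "a k * m + b k * n = d" for k
  proof -
    have "a k * m + b k * n = d * (u * m + v * n)" by (simp add: a_def b_def algebra_simps)
    then show ?thesis by (simp add: uv)
  qed
  \<comment> \<open>As \<open>n\<close> and \<open>- m\<close> are at least 1, this many steps outweigh the starting solution.\<close>
  define K where "K = \<bar>d * u\<bar> + \<bar>d * v\<bar> + 1"
  have large: "a k \<ge> 1 \<and> b k \<ge> 1" if "k \<ge> K" for k
  proof -
    have "k \<ge> 0" using that by (simp add: K_def)
    then have "k * 1 \<le> k * n" "k * 1 \<le> k * (- m)" using assms(1,2) by (intro mult_left_mono; simp)+
    then have "k \<le> k * n" "k \<le> - (k * m)" by simp_all
    then show ?thesis using that unfolding a_def b_def K_def by linarith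
  qed
  have "a (K + 1) + b (K + 1) = a K + b K + (n - m)" by (simp add: a_def b_def algebra_simps)
  with assms(6) have "even (a K + b K) \<noteq> even (a (K + 1) + b (K + 1))" by simp
  then obtain k where k: "k \<ge> K" "even (a k + b k) \<longleftrightarrow> q"
    by (metis order_refl zle_add1_eq_le less_add_one order_less_imp_le)
  have "infinite (J - X)" "infinite (- J - X)" using assms by auto
  then obtain A B where A: "finite A" "card A = nat (a k)" "A \<subseteq> J - X"
    and B: "finite B" "card B = nat (b k)" "B \<subseteq> - J - X"
    by (meson infinite_arbitrarily_large)
  have AB: "A \<inter> B = {}" using A B by auto
  have "basis_degree m n J (A \<union> B) = (\<Sum>k\<in>A. m) + (\<Sum>k\<in>B. n)"
    unfolding basis_degree_def sum.union_disjoint[OF A(1) B(1) AB] using A(3) B(3)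
    by (intro arg_cong2[where f = "(+)"] sum.cong) auto
  also have "\<dots> = d" using A B large[OF k(1)] deg[of k] by simp
  finally have "basis_degree m n J (A \<union> B) = d" .
  moreover have "int (card (A \<union> B)) = a k + b k"
    using A B AB large[OF k(1)] by (simp add: card_Un_disjoint)
  then have "even (card (A \<union> B)) \<longleftrightarrow> q"
    using k(2) by (metis even_of_nat_iff)
  moreover have "A \<union> B \<noteq> {}" using A large[OF k(1)] by auto
  ultimately show ?thesis using A B by (intro exI[of _ "A \<union> B"]) auto
qed

text \<open>
  Adding a representation of 1 and one of -1 yields a representation of 0, of odd total length in these
  two types. If \<open>n - m\<close> were even, then \<open>m\<close> and \<open>n\<close> would both be odd, and all representations of 0 would
  have even total length.
\<close>

lemma odd_difference_of_type_2_or_3: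
  fixes m n :: int
  assumes "gcd m n = 1" and "has_grading_type m n 2 \<or> has_grading_type m n 3"
  shows "odd (n - m)"
proof
  assume even: "even (n - m)"
  have "odd m \<and> odd n"
  proof (rule ccontr)
    assume "\<not> (odd m \<and> odd n)"
    with even have "2 dvd m" "2 dvd n" by auto
    then have "2 dvd gcd m n" by simp
    with assms(1) show False by simp
  qed
  then have parity: "even (\<alpha> + \<beta>)" if "0 = int \<alpha> * m + int \<beta> * n" for \<alpha> \<beta>
  proof -
    have "even (int \<alpha> * m + int \<beta> * n)" using that by simp
    then show ?thesis using \<open>odd m \<and> odd n\<close> by simp
  qed
  obtain \<alpha> \<beta> \<alpha>' \<beta>' where rep: "minimal_representation m n 1 \<alpha> \<beta>" "minimal_representation m n (- 1) \<alpha>' \<beta>'"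
    and "even (\<alpha> + \<beta>) \<noteq> even (\<alpha>' + \<beta>')"
    using assms(2) unfolding has_grading_type_def by auto
  then have "odd ((\<alpha> + \<alpha>') + (\<beta> + \<beta>'))" by auto
  moreover have "0 = int (\<alpha> + \<alpha>') * m + int (\<beta> + \<beta>') * n"
    using rep unfolding minimal_representation_def by (simp add: algebra_simps)
  ultimately show False using parity by blast
qed

lemma grassmann_basis_nonzero: "finite S \<Longrightarrow> grassmann_basis S \<noteq> (0 :: 'f::field grassmann)"
proof
  assume "finite S" "grassmann_basis S = (0 :: 'f grassmann)"
  then have "coord (grassmann_basis S :: 'f grassmann) S = 0" by (simp add: zero_grassmann.rep_eq)
  with \<open>finite S\<close> show False by (simp add: grassmann_basis.rep_eq)
qed

text \<open>
  The monomials are chosen one after the other, each avoiding the generators used before; a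
  product of monomials with disjoint supports is plus or minus a monomial. The condition \<open>S \<noteq> {}\<close> is there
  because square zero is needed also for degree 0, where 1 is a monomial of even length.
\<close>

lemma exists_monomials_with_nonzero_product:
  assumes ex: "\<And>X d q. finite X \<Longrightarrow> \<exists>S. finite S \<and> S \<noteq> {} \<and> S \<inter> X = {} \<and> deg S = d \<and>
    (even (card S) \<longleftrightarrow> q)"
  shows "\<exists>Ss. list_all2 (\<lambda>(d, q) S. finite S \<and> S \<noteq> {} \<and> deg S = d \<and> (even (card S) \<longleftrightarrow> q)) specs Ss
    \<and> prod_list (map grassmann_basis Ss) \<noteq> (0 :: 'f::field grassmann)"
proof -
  let ?R = "\<lambda>(d, q) S. finite S \<and> S \<noteq> {} \<and> deg S = d \<and> (even (card S) \<longleftrightarrow> q)"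
  have "\<exists>Ss c. list_all2 ?R specs Ss \<and> finite (\<Union> (set Ss)) \<and> c \<noteq> (0 :: 'f) \<and>
    prod_list (map grassmann_basis Ss) = grassmann_scale c (grassmann_basis (\<Union> (set Ss)))"
  proof (induction specs)
    case Nil
    show ?case by (intro exI[of _ "[]"] exI[of _ 1]) (simp add: grassmann_basis_empty)
  next
    case (Cons s specs)
    obtain d q where s: "s = (d, q)" by fastforce
    obtain Ss and c :: 'f where Ss: "list_all2 ?R specs Ss" "finite (\<Union> (set Ss))" "c \<noteq> 0"
      "prod_list (map grassmann_basis Ss) = grassmann_scale c (grassmann_basis (\<Union> (set Ss)))"
      using Cons.IH by blast
    obtain S where S: "finite S" "S \<noteq> {}" "S \<inter> \<Union> (set Ss) = {}" "deg S = d" "even (card S) \<longleftrightarrow> q"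
      using ex[OF Ss(2), where d = d and q = q] by blast
    have "prod_list (map grassmann_basis (S # Ss)) =
      grassmann_scale (c * shuffle_sign S (\<Union> (set Ss))) (grassmann_basis (\<Union> (set (S # Ss))) :: 'f grassmann)"
      using S(3) grassmann_basis_mult[OF S(1) Ss(2), where ?'a = 'f]
      by (simp add: Ss(4) grassmann_scale_mult_right)
    moreover have "c * shuffle_sign S (\<Union> (set Ss)) \<noteq> 0"
      using Ss(3) by (simp add: shuffle_sign_def)
    moreover have "list_all2 ?R (s # specs) (S # Ss)" using S Ss s by simp
    moreover have "finite (\<Union> (set (S # Ss)))" using S Ss by simp
    ultimately show ?case by (intro exI conjI)
  qed
  then obtain Ss and c :: 'f where "list_all2 ?R specs Ss" "finite (\<Union> (set Ss))" "c \<noteq> 0"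
    "prod_list (map grassmann_basis Ss) = grassmann_scale c (grassmann_basis (\<Union> (set Ss)))"
    by blast
  then show ?thesis
    by (intro exI[of _ Ss] conjI) (simp_all add: grassmann_basis_nonzero)
qed

lemma fibre_sum_component:
  assumes "\<And>r. grassmann.subspace (A r)" "\<And>y b. (y, b) \<in> set zs \<Longrightarrow> b \<in> A (deg y)"
  shows "fibre_sum zs x \<in> A (deg x)"
  using assms(2)
proof (induction zs)
  case (Cons p zs)
  obtain y b where p: "p = (y, b)" by fastforce
  have "fibre_sum zs x \<in> A (deg x)" by (rule Cons.IH) (simp add: Cons.prems)
  moreover have "(if x = y then b else 0) \<in> A (deg x)"
    using Cons.prems[of y b] grassmann.subspace_0[OF assms(1)] by (simp add: p)
  ultimately show ?case by (simp only: p fibre_sum.simps grassmann.subspace_add[OF assms(1)])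
qed (simp add: grassmann.subspace_0[OF assms(1)])

lemma of_nat_mult_grassmann: "of_nat k * a = grassmann_scale (of_nat k) (a :: 'f::field grassmann)"
  by (induction k) (simp_all add: distrib_right grassmann.scale_left_distrib)

section \<open>Linear independence of the normal forms\<close>

text \<open>
  A substitution tailored to one normal form \<open>(us\<^sub>0, vs\<^sub>0)\<close>: a variable is sent to \<open>t x + e x\<close>, where \<open>t x\<close>
  is the sum of one even monomial for each occurrence of \<open>x\<close> in \<open>us\<^sub>0\<close>, and \<open>e x\<close> is an odd monomial if \<open>x\<close>
  occurs in \<open>vs\<^sub>0\<close> and 0 otherwise. In the presence of the commutators of \<open>vs\<^sub>0\<close>, which use up all odd
  monomials, only the even part of the other factors survives.
\<close>

lemma separating_substitution:
  fixes us0 vs0 :: "gvar list"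
  assumes ex: "\<And>X d q. finite X \<Longrightarrow> \<exists>S. finite S \<and> S \<noteq> {} \<and> S \<inter> X = {} \<and>
      basis_degree m n J S = d \<and> (even (card S) \<longleftrightarrow> q)"
    and vs0: "distinct vs0" "even (length vs0)"
  obtains \<phi> :: "gvar \<Rightarrow> 'f::field_char_0 grassmann"
  where "\<And>x. \<phi> x \<in> grassmann_component m n J (var_degree x)"
    and "prod_list (map \<phi> us0) * comm_prod (map \<phi> vs0) \<noteq> 0"
    and "\<And>us vs. even (length vs) \<Longrightarrow> \<not> set vs \<subseteq> set vs0 \<Longrightarrow>
      prod_list (map \<phi> us) * comm_prod (map \<phi> vs) = 0"
    and "\<And>us. length us0 \<le> length us \<Longrightarrow> mset us \<noteq> mset us0 \<Longrightarrow>
      prod_list (map \<phi> us) * comm_prod (map \<phi> vs0) = 0"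
proof -
  let ?R = "\<lambda>(d, q) S. finite S \<and> S \<noteq> {} \<and> basis_degree m n J S = d \<and> (even (card S) \<longleftrightarrow> q)"
  let ?E = "map (\<lambda>x. (var_degree x, True)) us0" and ?O = "map (\<lambda>x. (var_degree x, False)) vs0"
  obtain Ss where "list_all2 ?R (?E @ ?O) Ss"
    and nz: "prod_list (map grassmann_basis Ss) \<noteq> (0 :: 'f grassmann)"
    using exists_monomials_with_nonzero_product[OF ex, of "?E @ ?O"] by blast
  then obtain Bs Cs where Ss: "Ss = Bs @ Cs" and Bs: "list_all2 ?R ?E Bs" and Cs: "list_all2 ?R ?O Cs"
    by (auto simp: list_all2_append1)
  have len: "length Bs = length us0" "length Cs = length vs0"
    using Bs Cs by (auto dest: list_all2_lengthD)
  let ?A = "grassmann_component m n J :: int \<Rightarrow> 'f grassmann set"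
  interpret graded_algebra grassmann_scale ?A by (rule graded_algebra_grassmann)
  have basis_component: "grassmann_basis S \<in> ?A d" if "finite S" "basis_degree m n J S = d" for S d
    using that unfolding grassmann_component_def by (intro grassmann.span_base) blast

  define zs :: "(gvar \<times> 'f grassmann) list" where "zs = zip us0 (map grassmann_basis Bs)"
  define t where "t = fibre_sum zs"
  have zs_maps: "map fst zs = us0" "map snd zs = map grassmann_basis Bs" "length zs = length us0"
    by (simp_all add: zs_def len)
  have zs: "\<exists>S. b = grassmann_basis S \<and> finite S \<and> S \<noteq> {} \<and> basis_degree m n J S = var_degree y \<and>
      even (card S)"
    if yb: "(y, b) \<in> set zs" for y b
  proof -
    obtain i where i: "i < length us0" "y = us0 ! i" "b = grassmann_basis (Bs ! i)"
      using yb len by (auto simp: zs_def in_set_zip)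
    then show ?thesis using list_all2_nthD[OF Bs, of i] by auto
  qed
  have zs_central: "central (snd p) \<and> snd p * snd p = 0" if "p \<in> set zs" for p
  proof -
    obtain S where "snd p = grassmann_basis S" "finite S" "S \<noteq> {}" "even (card S)"
      using zs[of "fst p" "snd p"] \<open>p \<in> set zs\<close> by auto
    then show ?thesis by (simp add: even_grassmann_basis_central grassmann_basis_mult)
  qed
  have t_central: "central (t x)" for x
    unfolding t_def by (rule central_fibre_sum) (simp add: zs_central)
  have t_component: "t x \<in> ?A (var_degree x)" for x
    unfolding t_def
  proof (rule fibre_sum_component[where A = ?A])
    show "b \<in> ?A (var_degree y)" if "(y, b) \<in> set zs" for y b
      using zs[OF that] basis_component by blast
  qed (rule subspace_component)
  obtain c where c: "c > 0" "\<And>us. length us \<ge> length us0 \<Longrightarrow> prod_list (map t us) =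
      (if mset us = mset us0 then of_nat c * prod_list (map grassmann_basis Bs) else 0)"
    using prod_fibre_sum[of zs, OF zs_central] unfolding zs_maps t_def by blast

  define C where "C x = the (map_of (zip vs0 Cs) x)" for x
  define e :: "gvar \<Rightarrow> 'f grassmann"
    where "e x = (if x \<in> set vs0 then grassmann_basis (C x) else 0)" for x
  have C_nth: "C (vs0 ! i) = Cs ! i" if "i < length vs0" for i
    using map_of_zip_nth[of vs0 Cs i] vs0(1) len(2) that by (simp add: C_def)
  have C: "finite (C x)" "C x \<noteq> {}" "basis_degree m n J (C x) = var_degree x" "odd (card (C x))"
    if x: "x \<in> set vs0" for x
  proof -
    obtain i where i: "i < length vs0" "x = vs0 ! i" using x by (auto simp: in_set_conv_nth)
    then have "?R (?O ! i) (C x)"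
      using list_all2_nthD[OF Cs, of i] C_nth[of i] by simp
    with i show "finite (C x)" "C x \<noteq> {}" "basis_degree m n J (C x) = var_degree x" "odd (card (C x))"
      by simp_all
  qed
  have e_vs0: "map e vs0 = map grassmann_basis Cs"
    by (rule nth_equalityI) (auto simp: len e_def C_nth)
  have e_component: "e x \<in> ?A (var_degree x)" for x
    using C basis_component grassmann.subspace_0[OF subspace_component] by (simp add: e_def)
  have e_anti: "e x * e y = - (e y * e x)" for x y
  proof (cases "x \<in> set vs0 \<and> y \<in> set vs0")
    case True
    then show ?thesis
      using odd_grassmann_basis_anticommute[OF C(1,4) C(1,4), of x y, where ?'f = 'f]
      by (simp add: e_def)
  qed (auto simp: e_def)
  have e_square: "e x * e x = 0" for x
    using C by (simp add: e_def grassmann_basis_mult)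

  define \<phi> where "\<phi> x = t x + e x" for x
  have comm: "comm_prod (map \<phi> vs) = of_nat (2 ^ (length vs div 2)) * prod_list (map e vs)"
    if "even (length vs)" for vs
    unfolding \<phi>_def using t_central e_anti that by (rule comm_prod_central_plus_odd)
  \<comment> \<open>If \<open>e x\<close> is not 0, it is a factor of the product of commutators, and its square is 0.\<close>
  have kill: "e x * comm_prod (map \<phi> vs0) = 0" for x
  proof (cases "x \<in> set vs0")
    case True
    then have "e x * prod_list (map e vs0) = 0"
      using e_anti e_square by (intro anticommuting_mult_prod_list)
    then show ?thesis
      using of_nat_mult_swap[of 1 "e x" "2 ^ (length vs0 div 2)" "prod_list (map e vs0)"]
      by (simp add: comm[OF vs0(2)])
  qed (simp add: e_def)
  have reduce: "prod_list (map \<phi> us) * comm_prod (map \<phi> vs0) =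
      prod_list (map t us) * comm_prod (map \<phi> vs0)" for us
    using prod_list_central_plus_annihilator[of t e, OF t_central kill] unfolding \<phi>_def by simp
  show thesis
  proof (rule that)
    show "\<phi> x \<in> ?A (var_degree x)" for x
      unfolding \<phi>_def by (intro grassmann.subspace_add subspace_component t_component e_component)
    show "prod_list (map \<phi> us0) * comm_prod (map \<phi> vs0) \<noteq> 0"
    proof -
      have "prod_list (map \<phi> us0) * comm_prod (map \<phi> vs0) =
          prod_list (map t us0) * comm_prod (map \<phi> vs0)" by (rule reduce)
      also have "\<dots> = of_nat c * prod_list (map grassmann_basis Bs) *
          (of_nat (2 ^ (length vs0 div 2)) * prod_list (map grassmann_basis Cs))"
        unfolding comm[OF vs0(2)] e_vs0 using c(2)[of us0] by simp
      also have "\<dots> = of_nat (c * 2 ^ (length vs0 div 2)) * prod_list (map grassmann_basis Ss)"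
        by (simp only: of_nat_mult_swap Ss map_append prod_list.append)
      also have "\<dots> = grassmann_scale (of_nat (c * 2 ^ (length vs0 div 2)))
          (prod_list (map grassmann_basis Ss))"
        by (rule of_nat_mult_grassmann)
      finally show ?thesis using c(1) nz by simp
    qed
    show "prod_list (map \<phi> us) * comm_prod (map \<phi> vs) = 0"
      if vs: "even (length vs)" "\<not> set vs \<subseteq> set vs0" for us vs
    proof -
      obtain x where x: "x \<in> set vs" "x \<notin> set vs0" using vs(2) by blast
      then obtain p q where "vs = p @ x # q" by (meson split_list)
      moreover have "e x = 0" using x by (simp add: e_def)
      ultimately have "prod_list (map e vs) = 0" by simp
      then show ?thesis by (simp add: comm[OF vs(1)])
    qed
    show "prod_list (map \<phi> us) * comm_prod (map \<phi> vs0) = 0"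
      if "length us0 \<le> length us" "mset us \<noteq> mset us0" for us
      unfolding reduce using c(2)[OF that(1)] that(2) by simp
  qed
qed

theorem proposition3p14:
  fixes m n :: int and J :: "nat set"
  assumes "m < 0" and "0 < n" and "gcd m n = 1"
    and "infinite J" and "infinite (- J)"
    and "has_grading_type m n 2 \<or> has_grading_type m n 3"
  shows "graded_identities grassmann_scale (grassmann_component m n J) =
    (TZ_V1 :: 'f::field_char_0 free_algebra set)"
proof
  let ?A = "grassmann_component m n J :: int \<Rightarrow> 'f grassmann set"
  interpret graded_algebra grassmann_scale ?A by (rule graded_algebra_grassmann)
  show V1_le: "TZ_V1 \<subseteq> graded_identities grassmann_scale ?A"
    by (rule TZ_V1_least[OF TZ_ideal_graded_identities])
      (simp add: graded_identities_def grassmann.free_eval_commutator grassmann_triple_commutator)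
  note ex = exists_monomial_of_degree_and_parity
    [OF assms(1-5) odd_difference_of_type_2_or_3[OF assms(3,6)]]
  let ?N = "\<lambda>(us, vs). normal_form us vs :: 'f free_algebra"
  show "graded_identities grassmann_scale ?A \<subseteq> TZ_V1"
  proof
    fix f :: "'f free_algebra" assume f: "f \<in> graded_identities grassmann_scale ?A"
    have "f \<in> free.span (?N ` normal_index \<union> TZ_V1)"
      using span_normal_forms[OF two_sided_ideal_TZ_V1 triple_commutator_in_TZ_V1] by blast
    then obtain h g where fhg: "f = h + g" "h \<in> free.span (?N ` normal_index)" "g \<in> free.span TZ_V1"
      unfolding free.span_Un by blast
    have g: "g \<in> TZ_V1" using fhg(3) free.span_eq_iff subspace_TZ_V1 by blast
    have h_id: "free_eval grassmann_scale \<phi> h = 0" if "\<And>x. \<phi> x \<in> ?A (var_degree x)" for \<phi>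
    proof -
      have "free_eval grassmann_scale \<phi> f = 0" "free_eval grassmann_scale \<phi> g = 0"
        using f g V1_le that unfolding graded_identities_def by blast+
      then show ?thesis using grassmann.free_eval_add[of \<phi> h g] by (simp add: fhg(1))
    qed
    obtain T r where T: "finite T" "T \<subseteq> ?N ` normal_index" "h = (\<Sum>a\<in>T. free_scale (r a) a)"
      using fhg(2) unfolding free.span_explicit by blast
    obtain I where I: "I \<subseteq> normal_index" "inj_on ?N I" "T = ?N ` I"
      using T(2) unfolding subset_image_inj by blast
    define l where "l p = r (?N p)" for p
    have fin: "finite I" using T(1) I(2,3) by (simp add: finite_image_iff)
    have h: "h = (\<Sum>p\<in>I. free_scale (l p) (?N p))"
      unfolding T(3) I(3) l_def using I(2) by (simp add: sum.reindex)
    have "l p = 0" if "p \<in> I" for p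
    proof (rule ccontr)
      assume "l p \<noteq> 0"
      \<comment> \<open>The least nonvanishing term, first by the length of the commutator part, then by that of the word.\<close>
      let ?lt = "measures [\<lambda>p :: gvar list \<times> gvar list. length (snd p), \<lambda>p. length (fst p)]"
      obtain p0 where p0: "p0 \<in> {p \<in> I. l p \<noteq> 0}" "\<And>p. (p, p0) \<in> ?lt \<Longrightarrow> p \<notin> {p \<in> I. l p \<noteq> 0}"
        using wfE_min[OF wf_measures, of p "{p \<in> I. l p \<noteq> 0}"] \<open>p \<in> I\<close> \<open>l p \<noteq> 0\<close> by blast
      obtain us0 vs0 where p0_eq: "p0 = (us0, vs0)" by fastforce
      have nf0: "canonical us0" "canonical vs0" "distinct vs0" "even (length vs0)"
        using p0 I(1) by (auto simp: p0_eq normal_index_def)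
      obtain \<phi> :: "gvar \<Rightarrow> 'f grassmann" where
        \<phi>: "\<And>x. \<phi> x \<in> ?A (var_degree x)"
        and lead: "prod_list (map \<phi> us0) * comm_prod (map \<phi> vs0) \<noteq> 0"
        and vanish_vs: "\<And>us vs. even (length vs) \<Longrightarrow> \<not> set vs \<subseteq> set vs0 \<Longrightarrow>
          prod_list (map \<phi> us) * comm_prod (map \<phi> vs) = 0"
        and vanish_us: "\<And>us. length us0 \<le> length us \<Longrightarrow> mset us \<noteq> mset us0 \<Longrightarrow>
          prod_list (map \<phi> us) * comm_prod (map \<phi> vs0) = 0"
        using separating_substitution[OF ex nf0(3,4), of us0, where ?'f = 'f] by blast
      have others: "grassmann_scale (l p) (free_eval grassmann_scale \<phi> (?N p)) = 0"
        if "p \<in> I" "p \<noteq> p0" for p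
      proof (cases "l p = 0")
        case False
        obtain us vs where p: "p = (us, vs)" by fastforce
        have nf: "canonical us" "canonical vs" "distinct vs" "even (length vs)"
          using \<open>p \<in> I\<close> I(1) by (auto simp: p normal_index_def)
        have "(p, p0) \<notin> ?lt" using p0(2) \<open>p \<in> I\<close> False by blast
        then have min: "length vs0 < length vs \<or> length vs0 = length vs \<and> length us0 \<le> length us"
          by (auto simp: p p0_eq)
        have "prod_list (map \<phi> us) * comm_prod (map \<phi> vs) = 0"
        proof (cases "set vs \<subseteq> set vs0")
          case True
          have card: "card (set vs) = length vs" "card (set vs0) = length vs0"
            using nf(3) nf0(3) by (simp_all add: distinct_card)
          have "length vs \<le> length vs0"
            using card_mono[OF _ True] card by simp
          then have len: "length vs = length vs0" "length us0 \<le> length us" using min by auto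
          then have "set vs = set vs0" using card True by (intro card_subset_eq) auto
          then have "mset vs = mset vs0" using nf(3) nf0(3) by (simp add: set_eq_iff_mset_eq_distinct)
          then have "vs = vs0" using nf nf0 by (intro canonical_unique)
          moreover from this have "mset us \<noteq> mset us0"
            using \<open>p \<noteq> p0\<close> nf(1) nf0(1) canonical_unique by (auto simp: p p0_eq)
          ultimately show ?thesis using vanish_us len(2) by simp
        qed (use vanish_vs nf(4) in blast)
        then show ?thesis by (simp add: p grassmann.free_eval_normal_form)
      qed simp
      have "0 = free_eval grassmann_scale \<phi> h" using h_id[OF \<phi>] by simp
      also have "\<dots> = (\<Sum>p\<in>I. grassmann_scale (l p) (free_eval grassmann_scale \<phi> (?N p)))"
        unfolding h by (simp only: grassmann.free_eval_sum grassmann.free_eval_scale)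
      also have "\<dots> = grassmann_scale (l p0) (free_eval grassmann_scale \<phi> (?N p0))"
      proof -
        have "(\<Sum>p\<in>I - {p0}. grassmann_scale (l p) (free_eval grassmann_scale \<phi> (?N p))) = 0"
          by (intro sum.neutral ballI others) auto
        then show ?thesis using p0(1) by (subst sum.remove[OF fin, of p0]) (auto simp only: mem_Collect_eq add_0_right)
      qed
      finally show False
        using p0(1) lead by (simp add: p0_eq grassmann.free_eval_normal_form)
    qed
    then have "h = 0" unfolding h by (intro sum.neutral) simp
    then show "f \<in> TZ_V1" using fhg(1) g by simp
  qed
qed

end
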